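(* Noncommutative polynomials $f_1,\dots,f_t\in F\langle X\rangle$ are $M_n$-locally linearly dependent if and only if there exist central polynomials $c_1,\dots,c_t$ of $M_n$, not all of them polynomial identities of $M_n$, such that $\sum_{i=1}^tc_if_i$ is a polynomial identity of $M_n$.
   Context: $F$ is a field of characteristic $0$, $M_n=M_n(F)$, $F\langle X\rangle$ the free algebra on noncommuting $X=\{x_1,x_2,\dots\}$. Polynomials $f_1,\dots,f_t\in F\langle x_1,\dots,x_m\rangle$ are $M_n$-locally linearly dependent if $f_1(r_1,\dots,r_m),\dots,f_t(r_1,\dots,r_m)$ are linearly dependent over $F$ for all $r_1,\dots,r_m\in M_n$. A central polynomial of $M_n$ is an element of $F\langle X\rangle$ all of whose evaluations in $M_n$ are scalar matrices (constants included); a polynomial identity is one all of whose evaluations are $0$. *)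

theory Defs
  imports "HOL-Library.Poly_Mapping" "Jordan_Normal_Form.Matrix"
begin

text \<open>Noncommutative polynomials in the variables x_0, x_1, ...: finitely supported
  maps from words (lists of variable indices) to coefficients.\<close>
type_synonym 'a ncpoly = "nat list \<Rightarrow>\<^sub>0 'a"

definition ncmult :: "'a::comm_semiring_0 ncpoly \<Rightarrow> 'a ncpoly \<Rightarrow> 'a ncpoly" where
  "ncmult p q = (\<Sum>u\<in>Poly_Mapping.keys p. \<Sum>v\<in>Poly_Mapping.keys q. Poly_Mapping.single (u @ v) (Poly_Mapping.lookup p u * Poly_Mapping.lookup q v))"

definition word_eval :: "nat \<Rightarrow> (nat \<Rightarrow> 'a::comm_ring_1 mat) \<Rightarrow> nat list \<Rightarrow> 'a mat" where
  "word_eval n r w = foldr (\<lambda>k M. r k * M) w (1\<^sub>m n)"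

definition nc_eval :: "nat \<Rightarrow> (nat \<Rightarrow> 'a::comm_ring_1 mat) \<Rightarrow> 'a ncpoly \<Rightarrow> 'a mat" where
  "nc_eval n r p = mat n n (\<lambda>(i, j). \<Sum>w\<in>Poly_Mapping.keys p. Poly_Mapping.lookup p w * word_eval n r w $$ (i, j))"

definition matrix_assignment :: "nat \<Rightarrow> (nat \<Rightarrow> 'a mat) \<Rightarrow> bool" where
  "matrix_assignment n r \<longleftrightarrow> (\<forall>k. r k \<in> carrier_mat n n)"

definition poly_identity :: "nat \<Rightarrow> 'a::comm_ring_1 ncpoly \<Rightarrow> bool" where
  "poly_identity n p \<longleftrightarrow> (\<forall>r. matrix_assignment n r \<longrightarrow> nc_eval n r p = 0\<^sub>m n n)"

definition central_poly :: "nat \<Rightarrow> 'a::comm_ring_1 ncpoly \<Rightarrow> bool" where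
  "central_poly n p \<longleftrightarrow> (\<forall>r. matrix_assignment n r \<longrightarrow> (\<exists>c. nc_eval n r p = c \<cdot>\<^sub>m 1\<^sub>m n))"

definition mats_lin_dependent :: "nat \<Rightarrow> nat \<Rightarrow> (nat \<Rightarrow> 'a::field mat) \<Rightarrow> bool" where
  "mats_lin_dependent n t A \<longleftrightarrow>
     (\<exists>a. (\<exists>i<t. a i \<noteq> 0) \<and>
          mat n n (\<lambda>(i, j). \<Sum>k<t. a k * A k $$ (i, j)) = 0\<^sub>m n n)"

definition locally_lin_dependent :: "nat \<Rightarrow> nat \<Rightarrow> (nat \<Rightarrow> 'a::field ncpoly) \<Rightarrow> bool" where
  "locally_lin_dependent n t f \<longleftrightarrow>
     (\<forall>r. matrix_assignment n r \<longrightarrow> mats_lin_dependent n t (\<lambda>i. nc_eval n r (f i)))"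

end

theory Submission
  imports Defs "HOL-Combinatorics.Permutations" "HOL-Computational_Algebra.Polynomial"
begin

text \<open>
  Sufficiency is Zariski density along lines: on a line through the given point and a point where some
  \<open>c_i\<close> does not vanish, the relation becomes a polynomial relation in one variable \<open>s\<close>; dividing the
  coefficients by their common power of \<open>s\<close> leaves a nontrivial relation at \<open>s = 0\<close>.

  Necessity is Gaussian elimination with central pivots. If \<open>f_t\<close> is not an identity, there is a
  polynomial operator \<open>Q\<close> such that \<open>Q g\<close> always evaluates to \<open>tr (C g)\<close> times the identity matrix, with
  \<open>C\<close> independent of \<open>g\<close>, and \<open>Q f_t\<close> is not an identity. The polynomials
  \<open>Q(f_t) f_i - Q(f_i) f_t\<close> for \<open>i < t\<close> are again locally dependent, so induction applies. The operator
  \<open>Q\<close> is Razmyslov's: the Capelli polynomial alternates in \<open>n^2\<close> variables, hence inserting \<open>M\<close> in front of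
  each of them in turn yields \<open>n tr M\<close> times the polynomial, and by duality with respect to the trace form,
  interchanging the two parts of every monomial produces central values.
\<close>

subsection \<open>Evaluation\<close>

lemma word_eval_carrier [simp]:
  assumes "matrix_assignment n r"
  shows "word_eval n r w \<in> carrier_mat n n"
  using assms by (induction w) (auto simp: word_eval_def matrix_assignment_def intro!: mult_carrier_mat[of _ n n])

lemma word_eval_Nil [simp]: "word_eval n r [] = 1\<^sub>m n"
  by (simp add: word_eval_def)

lemma word_eval_Cons [simp]: "word_eval n r (k # w) = r k * word_eval n r w"
  by (simp add: word_eval_def)

lemma word_eval_append:
  assumes "matrix_assignment n r"
  shows "word_eval n r (u @ v) = word_eval n r u * word_eval n r v"
proof (induction u)
  case Nil
  show ?case using left_mult_one_mat[OF word_eval_carrier[OF assms]] by simp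
next
  case (Cons k u)
  have "r k \<in> carrier_mat n n" using assms by (simp add: matrix_assignment_def)
  then show ?case
    using Cons assms by (simp add: assoc_mult_mat[OF _ word_eval_carrier[OF assms] word_eval_carrier[OF assms]])
qed

lemma word_eval_cong:
  assumes "\<And>k. k \<in> set w \<Longrightarrow> r k = r' k"
  shows "word_eval n r w = word_eval n r' w"
  using assms by (induction w) auto

lemma nc_eval_carrier [simp]: "nc_eval n r p \<in> carrier_mat n n"
  and nc_eval_dim [simp]: "dim_row (nc_eval n r p) = n" "dim_col (nc_eval n r p) = n"
  by (simp_all add: nc_eval_def)

text \<open>Words can cancel in sums, so \<open>keys\<close> is not additive. Over a common finite
  superset evaluations are compared term by term, because words outside \<open>keys p\<close> have
  coefficient 0.\<close>

lemma nc_eval_superset: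
  assumes "i < n" "j < n" "finite S" "Poly_Mapping.keys p \<subseteq> S"
  shows "nc_eval n r p $$ (i, j) = (\<Sum>w\<in>S. Poly_Mapping.lookup p w * word_eval n r w $$ (i, j))"
proof -
  have "(\<Sum>w\<in>Poly_Mapping.keys p. Poly_Mapping.lookup p w * word_eval n r w $$ (i, j)) =
    (\<Sum>w\<in>S. Poly_Mapping.lookup p w * word_eval n r w $$ (i, j))"
    by (rule sum.mono_neutral_left) (use assms in \<open>auto simp: in_keys_iff\<close>)
  then show ?thesis using assms by (simp add: nc_eval_def)
qed

lemma nc_eval_zero: "i < n \<Longrightarrow> j < n \<Longrightarrow> nc_eval n r 0 $$ (i, j) = 0"
  by (simp add: nc_eval_def)

lemma nc_eval_add:
  assumes "i < n" "j < n"
  shows "nc_eval n r (p + q) $$ (i, j) = nc_eval n r p $$ (i, j) + nc_eval n r q $$ (i, j)"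
proof -
  let ?S = "Poly_Mapping.keys p \<union> Poly_Mapping.keys q"
  have "Poly_Mapping.keys (p + q) \<subseteq> ?S" by (rule Poly_Mapping.keys_add)
  then show ?thesis using assms
    by (simp add: nc_eval_superset[of i n j ?S] lookup_add distrib_right sum.distrib)
qed

lemma nc_eval_uminus:
  assumes "i < n" "j < n"
  shows "nc_eval n r (- p) $$ (i, j) = - nc_eval n r p $$ (i, j)"
  using nc_eval_add[OF assms, of r p "- p"] nc_eval_zero[OF assms, of r] by (simp add: eq_neg_iff_add_eq_0 add.commute)

lemma nc_eval_diff:
  assumes "i < n" "j < n"
  shows "nc_eval n r (p - q) $$ (i, j) = nc_eval n r p $$ (i, j) - nc_eval n r q $$ (i, j)"
  using nc_eval_add[OF assms, of r p "- q"] nc_eval_uminus[OF assms, of r q] by simp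

lemma nc_eval_sum:
  assumes "i < n" "j < n"
  shows "nc_eval n r (\<Sum>a\<in>A. p a) $$ (i, j) = (\<Sum>a\<in>A. nc_eval n r (p a) $$ (i, j))"
  by (induction A rule: infinite_finite_induct) (use assms in \<open>simp_all add: nc_eval_zero nc_eval_add\<close>)

lemma nc_eval_single:
  assumes "i < n" "j < n"
  shows "nc_eval n r (Poly_Mapping.single w c) $$ (i, j) = c * word_eval n r w $$ (i, j)"
  using assms by (simp add: nc_eval_superset[of i n j "{w}"])

lemma mult_mat_entry:
  assumes "A \<in> carrier_mat n n" "B \<in> carrier_mat n n" "i < n" "j < n"
  shows "(A * B) $$ (i, j) = (\<Sum>k<n. A $$ (i, k) * B $$ (k, j))"
  using assms by (auto simp: scalar_prod_def atLeast0LessThan)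

lemma nc_eval_mult:
  assumes "matrix_assignment n r"
  shows "nc_eval n r (ncmult p q) = nc_eval n r p * nc_eval n r q"
proof (rule eq_matI)
  fix i j assume "i < dim_row (nc_eval n r p * nc_eval n r q)" "j < dim_col (nc_eval n r p * nc_eval n r q)"
  then have ij: "i < n" "j < n" by auto
  let ?P = "Poly_Mapping.lookup p" and ?Q = "Poly_Mapping.lookup q"
  have "nc_eval n r (ncmult p q) $$ (i, j) =
    (\<Sum>u\<in>Poly_Mapping.keys p. \<Sum>v\<in>Poly_Mapping.keys q. ?P u * ?Q v * word_eval n r (u @ v) $$ (i, j))"
    by (simp add: ncmult_def nc_eval_sum nc_eval_single ij)
  also have "\<dots> = (\<Sum>u\<in>Poly_Mapping.keys p. \<Sum>v\<in>Poly_Mapping.keys q. \<Sum>k<n.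
      (?P u * word_eval n r u $$ (i, k)) * (?Q v * word_eval n r v $$ (k, j)))"
    by (simp add: word_eval_append[OF assms] mult_mat_entry[OF word_eval_carrier word_eval_carrier ij] assms
        sum_distrib_left mult_ac del: index_mult_mat)
  also have "\<dots> = (\<Sum>u\<in>Poly_Mapping.keys p. \<Sum>k<n. \<Sum>v\<in>Poly_Mapping.keys q.
      (?P u * word_eval n r u $$ (i, k)) * (?Q v * word_eval n r v $$ (k, j)))"
    by (intro sum.cong refl sum.swap)
  also have "\<dots> = (\<Sum>k<n. \<Sum>u\<in>Poly_Mapping.keys p. \<Sum>v\<in>Poly_Mapping.keys q.
      (?P u * word_eval n r u $$ (i, k)) * (?Q v * word_eval n r v $$ (k, j)))"
    by (rule sum.swap)
  also have "\<dots> = (\<Sum>k<n. nc_eval n r p $$ (i, k) * nc_eval n r q $$ (k, j))"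
    using ij by (intro sum.cong refl) (simp add: nc_eval_def sum_product)
  also have "\<dots> = (nc_eval n r p * nc_eval n r q) $$ (i, j)"
    by (rule mult_mat_entry[symmetric]) (use ij in auto)
  finally show "nc_eval n r (ncmult p q) $$ (i, j) = (nc_eval n r p * nc_eval n r q) $$ (i, j)" .
qed auto

lemma nc_eval_mult_scalar:
  assumes "matrix_assignment n r" "nc_eval n r p = c \<cdot>\<^sub>m 1\<^sub>m n" "i < n" "j < n"
  shows "nc_eval n r (ncmult p q) $$ (i, j) = c * nc_eval n r q $$ (i, j)"
proof -
  have "c \<cdot>\<^sub>m 1\<^sub>m n * nc_eval n r q = c \<cdot>\<^sub>m nc_eval n r q"
    using mult_smult_assoc_mat[of "1\<^sub>m n" n n "nc_eval n r q" n c] by simp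
  then show ?thesis using assms by (simp add: nc_eval_mult)
qed

text \<open>Variables that do not occur in \<open>p\<close> may be reassigned freely. This later
  allows fresh variables to be specialized without changing the value of a given polynomial.\<close>

lemma nc_eval_cong:
  assumes "\<And>w k. w \<in> Poly_Mapping.keys p \<Longrightarrow> k \<in> set w \<Longrightarrow> r k = r' k"
  shows "nc_eval n r p = nc_eval n r' p"
proof -
  have "word_eval n r w = word_eval n r' w" if "w \<in> Poly_Mapping.keys p" for w
    using assms that by (intro word_eval_cong) auto
  then show ?thesis by (simp add: nc_eval_def cong: sum.cong)
qed

subsection \<open>Restriction to lines\<close>

text \<open>The affine line with \<open>r\<close> at \<open>s = 0\<close> and \<open>r'\<close> at
  \<open>s = 1\<close>. The entrywise form makes every point of it a valid assignment without any
  condition on \<open>r\<close> and \<open>r'\<close>.\<close>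

definition line_assignment :: "nat \<Rightarrow> (nat \<Rightarrow> 'a::comm_ring_1 mat) \<Rightarrow> (nat \<Rightarrow> 'a mat) \<Rightarrow> 'a \<Rightarrow> nat \<Rightarrow> 'a mat" where
  "line_assignment n r r' s k = mat n n (\<lambda>(i, j). r k $$ (i, j) + s * (r' k $$ (i, j) - r k $$ (i, j)))"

lemma matrix_assignment_line [simp]: "matrix_assignment n (line_assignment n r r' s)"
  by (simp add: matrix_assignment_def line_assignment_def)

lemma line_assignment_endpoints:
  assumes "matrix_assignment n r" "matrix_assignment n r'"
  shows "line_assignment n r r' 0 = r" "line_assignment n r r' 1 = r'"
proof -
  have "dim_row (r k) = n" "dim_col (r k) = n" "dim_row (r' k) = n" "dim_col (r' k) = n" for k
    using assms by (auto simp: matrix_assignment_def)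
  then show "line_assignment n r r' 0 = r" "line_assignment n r r' 1 = r'"
    by (auto simp: line_assignment_def fun_eq_iff intro!: eq_matI)
qed

text \<open>Each letter contributes a matrix whose entries are affine in \<open>s\<close>, so the
  entries of the product are sums of products of affine forms.\<close>

lemma word_eval_line_poly:
  assumes "i < n" "j < n"
  shows "\<exists>P. \<forall>s. word_eval n (line_assignment n r r' s) w $$ (i, j) = poly P s"
  using assms
proof (induction w arbitrary: i j)
  case Nil
  then show ?case by (intro exI[of _ "[:if i = j then 1 else 0:]"]) auto
next
  case (Cons k w)
  then have "\<forall>l. \<exists>P. l < n \<longrightarrow> (\<forall>s. word_eval n (line_assignment n r r' s) w $$ (l, j) = poly P s)" by blast
  then obtain P where P: "\<And>l s. l < n \<Longrightarrow> word_eval n (line_assignment n r r' s) w $$ (l, j) = poly (P l) s"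
    by metis
  show ?case
  proof (intro exI allI)
    fix s
    have L: "line_assignment n r r' s k \<in> carrier_mat n n" by (simp add: line_assignment_def)
    have "word_eval n (line_assignment n r r' s) (k # w) $$ (i, j)
      = (\<Sum>l<n. line_assignment n r r' s k $$ (i, l) * word_eval n (line_assignment n r r' s) w $$ (l, j))"
      using mult_mat_entry[OF L word_eval_carrier[OF matrix_assignment_line] Cons.prems] by simp
    also have "\<dots> = poly (\<Sum>l<n. [:r k $$ (i, l), r' k $$ (i, l) - r k $$ (i, l):] * P l) s"
      using Cons.prems by (simp add: poly_sum P line_assignment_def algebra_simps)
    finally show "word_eval n (line_assignment n r r' s) (k # w) $$ (i, j)
      = poly (\<Sum>l<n. [:r k $$ (i, l), r' k $$ (i, l) - r k $$ (i, l):] * P l) s" .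
  qed
qed

lemma nc_eval_line_poly:
  assumes "i < n" "j < n"
  shows "\<exists>P. \<forall>s. nc_eval n (line_assignment n r r' s) p $$ (i, j) = poly P s"
proof -
  obtain P where P: "\<And>w s. word_eval n (line_assignment n r r' s) w $$ (i, j) = poly (P w) s"
    using word_eval_line_poly[OF assms] by metis
  show ?thesis
    by (rule exI[of _ "\<Sum>w\<in>Poly_Mapping.keys p. smult (Poly_Mapping.lookup p w) (P w)"])
      (use assms in \<open>simp add: nc_eval_def P poly_sum\<close>)
qed

section \<open>Central polynomials: closure properties and nonvanishing of products\<close>

lemma central_nonidentity_witness:
  assumes "n \<ge> 1" "central_poly n c" "\<not> poly_identity n c"
  obtains r where "matrix_assignment n r" "nc_eval n r c $$ (0, 0) \<noteq> 0"
proof -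
  obtain r where r: "matrix_assignment n r" "nc_eval n r c \<noteq> 0\<^sub>m n n"
    using assms(3) by (auto simp: poly_identity_def)
  obtain a where a: "nc_eval n r c = a \<cdot>\<^sub>m 1\<^sub>m n" using assms(2) r by (auto simp: central_poly_def)
  have "a \<noteq> 0" using r(2) by (auto simp: a)
  then show ?thesis using that[OF r(1)] a assms(1) by simp
qed

lemma central_poly_scalar:
  assumes "n \<ge> 1" "central_poly n c" "matrix_assignment n r"
  shows "nc_eval n r c = nc_eval n r c $$ (0, 0) \<cdot>\<^sub>m 1\<^sub>m n"
  using assms by (auto simp: central_poly_def)

lemma central_poly_mult:
  fixes c d :: "'a::comm_ring_1 ncpoly"
  assumes "central_poly n c" "central_poly n d"
  shows "central_poly n (ncmult c d)"
  unfolding central_poly_def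
proof (intro allI impI)
  fix r :: "nat \<Rightarrow> 'a mat" assume r: "matrix_assignment n r"
  obtain a b where a: "nc_eval n r c = a \<cdot>\<^sub>m 1\<^sub>m n" and b: "nc_eval n r d = b \<cdot>\<^sub>m 1\<^sub>m n"
    using assms r unfolding central_poly_def by meson
  have "nc_eval n r (ncmult c d) = (a * b) \<cdot>\<^sub>m 1\<^sub>m n"
    by (rule eq_matI) (simp_all add: nc_eval_mult_scalar[OF r a] b)
  then show "\<exists>a. nc_eval n r (ncmult c d) = a \<cdot>\<^sub>m 1\<^sub>m n" by blast
qed

lemma central_polyI:
  fixes c :: "'a::comm_ring_1 ncpoly"
  assumes "\<And>r. matrix_assignment n r \<Longrightarrow> \<exists>a. \<forall>i<n. \<forall>j<n. nc_eval n r c $$ (i, j) = (if i = j then a else 0)"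
  shows "central_poly n c"
  unfolding central_poly_def
proof (intro allI impI)
  fix r :: "nat \<Rightarrow> 'a mat" assume "matrix_assignment n r"
  then obtain a where "\<forall>i<n. \<forall>j<n. nc_eval n r c $$ (i, j) = (if i = j then a else 0)" using assms by blast
  then have "nc_eval n r c = a \<cdot>\<^sub>m 1\<^sub>m n" by (intro eq_matI) auto
  then show "\<exists>a. nc_eval n r c = a \<cdot>\<^sub>m 1\<^sub>m n" by blast
qed

lemma central_poly_entry:
  assumes "n \<ge> 1" "central_poly n c" "matrix_assignment n r" "i < n" "j < n"
  shows "nc_eval n r c $$ (i, j) = (if i = j then nc_eval n r c $$ (0, 0) else 0)"
  using assms by (auto simp: central_poly_def)

lemma central_poly_sum:
  fixes c :: "'b \<Rightarrow> 'a::comm_ring_1 ncpoly"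
  assumes "n \<ge> 1" "\<And>i. i \<in> A \<Longrightarrow> central_poly n (c i)"
  shows "central_poly n (\<Sum>i\<in>A. c i)"
proof (rule central_polyI)
  fix r :: "nat \<Rightarrow> 'a mat" assume r: "matrix_assignment n r"
  have "nc_eval n r (sum c A) $$ (i, j) = (if i = j then \<Sum>k\<in>A. nc_eval n r (c k) $$ (0, 0) else 0)"
    if "i < n" "j < n" for i j
  proof -
    have "nc_eval n r (sum c A) $$ (i, j) = (\<Sum>k\<in>A. if i = j then nc_eval n r (c k) $$ (0, 0) else 0)"
      unfolding nc_eval_sum[OF that] using assms r that by (intro sum.cong refl central_poly_entry)
    then show ?thesis by simp
  qed
  then show "\<exists>a. \<forall>i<n. \<forall>j<n. nc_eval n r (sum c A) $$ (i, j) = (if i = j then a else 0)"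
    by blast
qed

lemma central_poly_uminus:
  fixes c :: "'a::comm_ring_1 ncpoly"
  assumes "n \<ge> 1" "central_poly n c"
  shows "central_poly n (- c)"
proof (rule central_polyI)
  fix r :: "nat \<Rightarrow> 'a mat" assume r: "matrix_assignment n r"
  obtain a where a: "nc_eval n r c = a \<cdot>\<^sub>m 1\<^sub>m n"
    using assms r by (auto simp: central_poly_def)
  show "\<exists>a. \<forall>i<n. \<forall>j<n. nc_eval n r (- c) $$ (i, j) = (if i = j then a else 0)"
    by (intro exI[of _ "- a"]) (auto simp: nc_eval_uminus a)
qed

text \<open>On the line joining a nonvanishing point of \<open>c\<close> to one of \<open>d\<close>,
  both scalar values are nonzero polynomials in \<open>s\<close>. So is their product, and over an
  infinite field some \<open>s\<close> is not a root of it.\<close>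

lemma central_poly_mult_nonidentity:
  fixes c d :: "'a::field_char_0 ncpoly"
  assumes n: "n \<ge> 1" and c: "central_poly n c" "\<not> poly_identity n c"
    and d: "central_poly n d" "\<not> poly_identity n d"
  shows "\<not> poly_identity n (ncmult c d)"
proof -
  obtain r where r: "matrix_assignment n r" "nc_eval n r c $$ (0, 0) \<noteq> 0"
    using central_nonidentity_witness[OF n c] .
  obtain r' where r': "matrix_assignment n r'" "nc_eval n r' d $$ (0, 0) \<noteq> 0"
    using central_nonidentity_witness[OF n d] .
  have n0: "0 < n" using n by simp
  let ?l = "line_assignment n r r'"
  obtain P where P: "\<And>s. nc_eval n (?l s) c $$ (0, 0) = poly P s"
    using nc_eval_line_poly[OF n0 n0] by blast
  obtain Q where Q: "\<And>s. nc_eval n (?l s) d $$ (0, 0) = poly Q s"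
    using nc_eval_line_poly[OF n0 n0] by blast
  have "poly P 0 \<noteq> 0" "poly Q 1 \<noteq> 0"
    using r r' P[of 0] Q[of 1] by (simp_all add: line_assignment_endpoints)
  then have "P * Q \<noteq> 0" by auto
  then obtain s where "poly (P * Q) s \<noteq> 0" by (metis poly_all_0_iff_0)
  then have "nc_eval n (?l s) (ncmult c d) $$ (0, 0) \<noteq> 0"
    using nc_eval_mult_scalar[OF _ central_poly_scalar[OF n c(1)] n0 n0, of "?l s" d] by (simp add: P Q)
  then show ?thesis
    using n0 by (auto simp: poly_identity_def intro!: exI[of _ "?l s"])
qed

section \<open>Sufficiency: a central relation gives local dependence\<close>

lemma central_relation_imp_locally_lin_dependent:
  fixes f c :: "nat \<Rightarrow> 'a::field_char_0 ncpoly"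
  assumes n: "n \<ge> 1" and central: "\<And>i. i < t \<Longrightarrow> central_poly n (c i)"
    and nonid: "i0 < t" "\<not> poly_identity n (c i0)"
    and rel: "poly_identity n (\<Sum>i<t. ncmult (c i) (f i))"
  shows "locally_lin_dependent n t f"
  unfolding locally_lin_dependent_def
proof (intro allI impI)
  fix r :: "nat \<Rightarrow> 'a mat" assume r: "matrix_assignment n r"
  obtain r' where r': "matrix_assignment n r'" "nc_eval n r' (c i0) $$ (0, 0) \<noteq> 0"
    using central_nonidentity_witness[OF n central[OF nonid(1)] nonid(2)] .
  have n0: "0 < n" using n by simp
  let ?l = "line_assignment n r r'"
  \<comment> \<open>For \<open>k < t\<close> the value of \<open>c k\<close> is a scalar matrix, so
    its entry (0, 0) determines it.\<close>
  define C where "C k = (SOME P. \<forall>s. nc_eval n (?l s) (c k) $$ (0, 0) = poly P s)" for k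
  have C: "nc_eval n (?l s) (c k) $$ (0, 0) = poly (C k) s" for k s
    unfolding C_def using someI_ex[OF nc_eval_line_poly[OF n0 n0]] by blast
  define F where "F k i j = (SOME P. \<forall>s. nc_eval n (?l s) (f k) $$ (i, j) = poly P s)" for k i j
  have F: "nc_eval n (?l s) (f k) $$ (i, j) = poly (F k i j) s" if "i < n" "j < n" for k i j s
    unfolding F_def using someI_ex[OF nc_eval_line_poly[OF that]] by blast
  have rel_poly: "(\<Sum>k<t. C k * F k i j) = 0" if ij: "i < n" "j < n" for i j
  proof -
    have "poly (\<Sum>k<t. C k * F k i j) s = 0" for s
    proof -
      have "poly (\<Sum>k<t. C k * F k i j) s = nc_eval n (?l s) (\<Sum>k<t. ncmult (c k) (f k)) $$ (i, j)"
        by (simp add: nc_eval_sum ij poly_sum C[symmetric] F[symmetric]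
            nc_eval_mult_scalar[OF matrix_assignment_line central_poly_scalar[OF n central matrix_assignment_line]])
      then show ?thesis using rel ij by (simp add: poly_identity_def)
    qed
    then show ?thesis using poly_all_0_iff_0 by blast
  qed
  have "poly (C i0) 1 \<noteq> 0"
    using r' C[of 1 i0] by (simp add: line_assignment_endpoints r)
  then have Ci0: "C i0 \<noteq> 0" by auto
  \<comment> \<open>All \<open>C k\<close> may vanish at \<open>s = 0\<close>, the given point.
    Their least order of vanishing there is the exponent of the largest power of \<open>s\<close>
    that divides all of them; it exists because \<open>C i0\<close> is nonzero.\<close>
  define e where "e = (LEAST e. \<exists>k<t. C k \<noteq> 0 \<and> order 0 (C k) = e)"
  have "\<exists>k<t. C k \<noteq> 0 \<and> order 0 (C k) = e"
    unfolding e_def by (rule LeastI_ex) (use Ci0 nonid(1) in auto)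
  then obtain k0 where k0: "k0 < t" "C k0 \<noteq> 0" "order 0 (C k0) = e" by blast
  have "[:0, 1:] ^ e dvd C k" if "k < t" for k
  proof (cases "C k = 0")
    case False
    then have "e \<le> order 0 (C k)" unfolding e_def using that by (intro Least_le) auto
    then show ?thesis using order_1[of 0 "C k"] by (metis minus_zero power_le_dvd)
  qed simp
  then have "\<forall>k. \<exists>D. k < t \<longrightarrow> C k = [:0, 1:] ^ e * D" by (meson dvdE)
  then obtain D where D: "\<And>k. k < t \<Longrightarrow> C k = [:0, 1:] ^ e * D k" by metis
  \<comment> \<open>A further factor \<open>s\<close> in \<open>D k0\<close> would raise the order
    of \<open>C k0\<close> at 0 above \<open>e\<close>.\<close>
  have "poly (D k0) 0 \<noteq> 0"
  proof
    assume "poly (D k0) 0 = 0"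
    then have "[:0, 1:] dvd D k0" by (simp add: poly_eq_0_iff_dvd)
    then have "[:0, 1:] ^ Suc e dvd C k0" using D[OF k0(1)] by (metis mult.commute mult_dvd_mono dvd_refl power_Suc)
    then show False using order_2[OF k0(2), of 0] k0(3) by simp
  qed
  moreover have "(\<Sum>k<t. poly (D k) 0 * nc_eval n r (f k) $$ (i, j)) = 0" if ij: "i < n" "j < n" for i j
  proof -
    have "[:0, 1:] ^ e * (\<Sum>k<t. D k * F k i j) = 0"
      using rel_poly[OF ij] by (simp add: sum_distrib_left D mult.assoc)
    \<comment> \<open>The power of \<open>s\<close> cancels because polynomials over a field form a
      domain. Evaluation at 0 then returns to the assignment \<open>r\<close>.\<close>
    then have "(\<Sum>k<t. D k * F k i j) = 0" by simp
    then have "poly (\<Sum>k<t. D k * F k i j) 0 = 0" by simp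
    then show ?thesis
      using F[OF ij, of 0] by (simp add: poly_sum line_assignment_endpoints r r'(1))
  qed
  ultimately show "mats_lin_dependent n t (\<lambda>i. nc_eval n r (f i))"
    unfolding mats_lin_dependent_def using k0(1)
    by (intro exI[of _ "\<lambda>k. poly (D k) 0"] conjI) (auto intro!: eq_matI)
qed

subsection \<open>Alternating multilinear functions of matrices\<close>

definition matrix_unit :: "nat \<Rightarrow> nat \<times> nat \<Rightarrow> 'a::comm_ring_1 mat" where
  "matrix_unit n j = mat n n (\<lambda>p. if p = j then 1 else 0)"

lemma matrix_unit_carrier [simp]: "matrix_unit n j \<in> carrier_mat n n"
  by (simp add: matrix_unit_def)

lemma matrix_unit_entry [simp]:
  "i < n \<Longrightarrow> k < n \<Longrightarrow> matrix_unit n j $$ (i, k) = (if (i, k) = j then 1 else 0)"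
  by (simp add: matrix_unit_def)

lemma matrix_assignment_upd [simp]:
  "matrix_assignment n x \<Longrightarrow> M \<in> carrier_mat n n \<Longrightarrow> matrix_assignment n (x(i := M))"
  by (simp add: matrix_assignment_def)

text \<open>Linearity in the \<open>i\<close>-th argument is expressed through the expansion in matrix units.\<close>

definition multilinear :: "nat \<Rightarrow> nat \<Rightarrow> ((nat \<Rightarrow> 'a::comm_ring_1 mat) \<Rightarrow> 'a) \<Rightarrow> bool" where
  "multilinear n m F \<longleftrightarrow> (\<forall>x i. matrix_assignment n x \<longrightarrow> i < m \<longrightarrow>
     F x = (\<Sum>j\<in>{..<n} \<times> {..<n}. x i $$ j * F (x(i := matrix_unit n j))))"

definition alternating :: "nat \<Rightarrow> nat \<Rightarrow> ((nat \<Rightarrow> 'a::comm_ring_1 mat) \<Rightarrow> 'a) \<Rightarrow> bool" where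
  "alternating n m F \<longleftrightarrow> (\<forall>x a b. matrix_assignment n x \<longrightarrow> a < m \<longrightarrow> b < m \<longrightarrow> a \<noteq> b \<longrightarrow>
     F (x \<circ> Transposition.transpose a b) = - F x)"

text \<open>Expanding one argument after another in matrix units reduces the claim to tuples of
  matrix units.\<close>

lemma multilinear_eq_0:
  assumes lin: "multilinear n m H"
    and base: "\<And>x. matrix_assignment n x \<Longrightarrow> \<forall>i<m. x i \<in> matrix_unit n ` ({..<n} \<times> {..<n}) \<Longrightarrow> H x = 0"
    and x: "matrix_assignment n x"
  shows "H x = 0"
proof -
  \<comment> \<open>In the induction \<open>k\<close> bounds the arguments still to be expanded:
    those from \<open>k\<close> on are matrix units already.\<close>
  have "H x = 0" if "k \<le> m" "matrix_assignment n x"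
    "\<forall>i. k \<le> i \<and> i < m \<longrightarrow> x i \<in> matrix_unit n ` ({..<n} \<times> {..<n})" for k x
    using that
  proof (induction k arbitrary: x)
    case 0
    then show ?case using base by simp
  next
    case (Suc k)
    have "H (x(k := matrix_unit n j)) = 0" if "j \<in> {..<n} \<times> {..<n}" for j
      using Suc.prems that by (intro Suc.IH) (auto simp: matrix_assignment_def le_Suc_eq Suc_le_eq)
    moreover have "H x = (\<Sum>j\<in>{..<n} \<times> {..<n}. x k $$ j * H (x(k := matrix_unit n j)))"
      using lin Suc.prems unfolding multilinear_def by simp
    ultimately show ?case by simp
  qed
  note * = this
  show ?thesis by (rule *[of m]) (use x in auto)
qed

text \<open>Exchanging the two equal arguments fixes \<open>x\<close>, so \<open>F x\<close> is its
  own negative; characteristic 0 then gives 0.\<close>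

lemma alternating_eq_0:
  fixes F :: "(nat \<Rightarrow> 'a::field_char_0 mat) \<Rightarrow> 'a"
  assumes "alternating n m F" "matrix_assignment n x" "a < m" "b < m" "a \<noteq> b" "x a = x b"
  shows "F x = 0"
proof -
  have "x \<circ> Transposition.transpose a b = x"
    using assms(6) by (auto simp: fun_eq_iff Transposition.transpose_def)
  then have "F x = - F x" using assms unfolding alternating_def by metis
  then show ?thesis by simp
qed

text \<open>With \<open>c\<close> equal to 1 or 0 this is the difference of the two sides of the
  Cramer identity below. Its multilinearity means that the identity need only be checked on matrix
  units.\<close>

lemma multilinear_cramer_defect:
  assumes lin: "multilinear n m F" and j': "j' \<in> {..<n} \<times> {..<n}"
  shows "multilinear n m (\<lambda>x. (\<Sum>i<m. x i $$ j' * F (x(i := matrix_unit n j))) - c * F x)"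
  unfolding multilinear_def
proof (intro allI impI)
  fix x :: "nat \<Rightarrow> 'a mat" and l assume x: "matrix_assignment n x" and l: "l < m"
  let ?J = "{..<n} \<times> {..<n}" and ?E = "matrix_unit n :: _ \<Rightarrow> 'a mat"
  have lin': "F x = (\<Sum>d\<in>?J. x i $$ d * F (x(i := ?E d)))" if "matrix_assignment n x" "i < m" for x i
    using lin that by (simp add: multilinear_def)
  \<comment> \<open>For \<open>i = l\<close> the dependence on \<open>x l\<close> sits in the
    coefficient, as \<open>F\<close> no longer sees \<open>x l\<close>; for
    \<open>i \<noteq> l\<close> it sits in \<open>F\<close>.\<close>
  have term_lin: "x i $$ j' * F (x(i := ?E j)) =
    (\<Sum>d\<in>?J. x l $$ d * ((x(l := ?E d)) i $$ j' * F ((x(l := ?E d))(i := ?E j))))" if "i < m" for i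
  proof (cases "i = l")
    case True
    have "(\<Sum>d\<in>?J. x l $$ d * (?E d $$ j' * F (x(l := ?E j)))) =
      (\<Sum>d\<in>?J. if d = j' then x l $$ d * F (x(l := ?E j)) else 0)"
      using j' by (intro sum.cong) (auto split: if_splits)
    also have "\<dots> = x l $$ j' * F (x(l := ?E j))" using j' by (subst sum.delta) auto
    finally show ?thesis using True by simp
  next
    case False
    have "F (x(i := ?E j)) = (\<Sum>d\<in>?J. x l $$ d * F (x(i := ?E j, l := ?E d)))"
      using lin'[of "x(i := ?E j)" l] x l False by simp
    then show ?thesis using False by (simp add: sum_distrib_left fun_upd_twist mult.left_commute)
  qed
  have "(\<Sum>i<m. x i $$ j' * F (x(i := ?E j))) - c * F x =
    (\<Sum>i<m. \<Sum>d\<in>?J. x l $$ d * ((x(l := ?E d)) i $$ j' * F ((x(l := ?E d))(i := ?E j))))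
    - (\<Sum>d\<in>?J. x l $$ d * (c * F (x(l := ?E d))))"
  proof (rule arg_cong2[where f = "(-)"])
    show "(\<Sum>i<m. x i $$ j' * F (x(i := ?E j))) =
      (\<Sum>i<m. \<Sum>d\<in>?J. x l $$ d * ((x(l := ?E d)) i $$ j' * F ((x(l := ?E d))(i := ?E j))))"
      by (intro sum.cong refl term_lin) simp
    show "c * F x = (\<Sum>d\<in>?J. x l $$ d * (c * F (x(l := ?E d))))"
      by (subst lin'[OF x l]) (simp add: sum_distrib_left mult.left_commute)
  qed
  also have "\<dots> = (\<Sum>d\<in>?J. x l $$ d * ((\<Sum>i<m. (x(l := ?E d)) i $$ j' * F ((x(l := ?E d))(i := ?E j))) - c * F (x(l := ?E d))))"
    by (subst sum.swap) (simp only: right_diff_distrib sum_subtractf sum_distrib_left)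
  finally show "(\<Sum>i<m. x i $$ j' * F (x(i := ?E j))) - c * F x =
    (\<Sum>d\<in>?J. x l $$ d * ((\<Sum>i<m. (x(l := ?E d)) i $$ j' * F ((x(l := ?E d))(i := ?E j))) - c * F (x(l := ?E d))))" .
qed

text \<open>Cramer's rule. The space of matrices has dimension \<open>n * n\<close>, so
  \<open>F\<close> is a multiple of the determinant of the coordinates of its arguments, and the sum
  pairs the coordinates in column \<open>j'\<close> with the cofactors of column
  \<open>j\<close>.\<close>

lemma alternating_cramer:
  fixes F :: "(nat \<Rightarrow> 'a::field_char_0 mat) \<Rightarrow> 'a"
  assumes lin: "multilinear n (n * n) F" and alt: "alternating n (n * n) F"
    and j: "j \<in> {..<n} \<times> {..<n}" and j': "j' \<in> {..<n} \<times> {..<n}"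
    and x: "matrix_assignment n x"
  shows "(\<Sum>i<n * n. x i $$ j' * F (x(i := matrix_unit n j))) = (if j = j' then F x else 0)"
proof -
  let ?J = "{..<n} \<times> {..<n}" and ?E = "matrix_unit n :: _ \<Rightarrow> 'a mat"
  define c :: 'a where "c = (if j = j' then 1 else 0)"
  have "(\<Sum>i<n * n. x i $$ j' * F (x(i := ?E j))) - c * F x = 0"
  proof (rule multilinear_eq_0[OF multilinear_cramer_defect[OF lin j'] _ x])
    fix x :: "nat \<Rightarrow> 'a mat"
    assume x: "matrix_assignment n x" and "\<forall>i<n * n. x i \<in> ?E ` ?J"
    then have "\<exists>\<kappa>. \<forall>i<n * n. \<kappa> i \<in> ?J \<and> x i = ?E (\<kappa> i)" by (intro choice) blast
    then obtain \<kappa> where \<kappa>: "\<And>i. i < n * n \<Longrightarrow> \<kappa> i \<in> ?J" "\<And>i. i < n * n \<Longrightarrow> x i = ?E (\<kappa> i)" by blast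
    have coeff: "x i $$ j' = (if \<kappa> i = j' then 1 else 0)" if "i < n * n" for i
      using \<kappa>[OF that] j' by auto
    have zero: "F (x(i := ?E j)) = 0" if "i < n * n" "b < n * n" "b \<noteq> i" "\<kappa> b = j" for i b
      using that x \<kappa> by (intro alternating_eq_0[OF alt _ that(1,2)]) auto
    show "(\<Sum>i<n * n. x i $$ j' * F (x(i := ?E j))) - c * F x = 0"
    proof (cases "inj_on \<kappa> {..<n * n}")
      \<comment> \<open>Counting makes \<kappa> a bijection onto the positions. Only the index
        \<open>i0\<close> carrying the unit at \<open>j'\<close> has a nonzero coefficient, and for
        \<open>j \<noteq> j'\<close> the replacement repeats the unit already present at index
        \<open>b\<close>.\<close>
      case True
      have "\<kappa> ` {..<n * n} = ?J"
      proof (rule card_subset_eq)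
        show "\<kappa> ` {..<n * n} \<subseteq> ?J" using \<kappa>(1) by (intro image_subsetI) simp
        show "card (\<kappa> ` {..<n * n}) = card ?J" using True by (simp add: card_image card_cartesian_product)
      qed simp
      then have "j \<in> \<kappa> ` {..<n * n}" "j' \<in> \<kappa> ` {..<n * n}" using j j' by simp_all
      then obtain b i0 where b: "b < n * n" "\<kappa> b = j" and i0: "i0 < n * n" "\<kappa> i0 = j'"
        by (elim imageE) simp
      have "(\<Sum>i<n * n. x i $$ j' * F (x(i := ?E j))) = (\<Sum>i<n * n. if i = i0 then F (x(i := ?E j)) else 0)"
        using i0 True by (intro sum.cong refl) (auto simp: coeff inj_on_def)
      also have "\<dots> = F (x(i0 := ?E j))" using i0 by simp
      also have "\<dots> = c * F x"
      proof (cases "j = j'")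
        case True
        then have "x(i0 := ?E j) = x" using i0 \<kappa>(2) by auto
        then show ?thesis using True by (simp add: c_def)
      next
        case False
        then show ?thesis using zero[of i0 b] i0 b by (auto simp: c_def)
      qed
      finally show ?thesis by simp
    next
      case False
      then obtain a b where ab: "a < n * n" "b < n * n" "a \<noteq> b" "\<kappa> a = \<kappa> b" by (auto simp: inj_on_def)
      have F0: "F x = 0" using ab \<kappa>(2) by (intro alternating_eq_0[OF alt x ab(1,2,3)]) auto
      have other: "F (x(i := ?E j)) = 0" if "i < n * n" "i \<noteq> a" "i \<noteq> b" for i
        using that x \<kappa>(2) ab by (intro alternating_eq_0[OF alt _ ab(1,2,3)]) auto
      \<comment> \<open>Since \<open>x a = x b\<close>, the two replacements differ by exchanging
        \<open>a\<close> and \<open>b\<close>. Their coefficients agree, so the only two terms that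
        can survive cancel.\<close>
      have "x(b := ?E j) = (x(a := ?E j)) \<circ> Transposition.transpose a b"
        using ab \<kappa>(2) by (auto simp: fun_eq_iff Transposition.transpose_def)
      then have swap: "F (x(b := ?E j)) = - F (x(a := ?E j))"
        using alt ab x unfolding alternating_def by simp
      have "(\<Sum>i<n * n. x i $$ j' * F (x(i := ?E j))) = (\<Sum>i\<in>{a, b}. x i $$ j' * F (x(i := ?E j)))"
        using ab other by (intro sum.mono_neutral_right) auto
      also have "\<dots> = 0" using ab swap by (simp add: coeff)
      finally show ?thesis using F0 by simp
    qed
  qed
  then show ?thesis by (auto simp: c_def)
qed

subsection \<open>The Capelli polynomial\<close>

text \<open>A single monomial; the Capelli polynomial arises from it by \<open>alternation\<close>.
  Each \<open>x k\<close> has separators on both sides, instead of one between neighbours, so that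
  under a suitable substitution every block returns to the same row index.\<close>

primrec capelli_monomial ::
  "nat \<Rightarrow> (nat \<Rightarrow> 'a::comm_ring_1 mat) \<Rightarrow> (nat \<Rightarrow> 'a mat) \<Rightarrow> nat list \<Rightarrow> (nat \<Rightarrow> 'a mat) \<Rightarrow> 'a mat" where
  "capelli_monomial n y y' [] x = 1\<^sub>m n"
| "capelli_monomial n y y' (k # l) x = y k * (x k * (y' k * capelli_monomial n y y' l x))"

lemma capelli_monomial_carrier [simp]:
  assumes "matrix_assignment n y" "matrix_assignment n y'" "matrix_assignment n x"
  shows "capelli_monomial n y y' l x \<in> carrier_mat n n"
  using assms by (induction l) (auto simp: matrix_assignment_def intro!: mult_carrier_mat[of _ n n])

lemma capelli_monomial_append:
  assumes "matrix_assignment n y" "matrix_assignment n y'" "matrix_assignment n x"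
  shows "capelli_monomial n y y' (l @ l') x = capelli_monomial n y y' l x * capelli_monomial n y y' l' x"
proof (induction l)
  case Nil
  show ?case using left_mult_one_mat[OF capelli_monomial_carrier[OF assms]] by simp
next
  case (Cons k l)
  have c: "y k \<in> carrier_mat n n" "x k \<in> carrier_mat n n" "y' k \<in> carrier_mat n n"
    using assms by (auto simp: matrix_assignment_def)
  note C = capelli_monomial_carrier[OF assms]
  show ?case
    by (simp add: Cons assoc_mult_mat[OF c(1) mult_carrier_mat[OF c(2) mult_carrier_mat[OF c(3) C]] C]
      assoc_mult_mat[OF c(2) mult_carrier_mat[OF c(3) C] C] assoc_mult_mat[OF c(3) C C])
qed

lemma capelli_monomial_cong:
  assumes "\<And>k. k \<in> set l \<Longrightarrow> x k = x' k"
  shows "capelli_monomial n y y' l x = capelli_monomial n y y' l x'"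
  using assms by (induction l) auto

definition capelli_prefix where
  "capelli_prefix n z y y' k x = z * (capelli_monomial n y y' [0..<k] x * y k)"

definition capelli_suffix where
  "capelli_suffix n y y' m k x = y' k * capelli_monomial n y y' [Suc k..<m] x"

text \<open>The leading factor \<open>z\<close> allows the value to be moved to a prescribed
  row.\<close>

definition capelli where
  "capelli n z y y' m x = z * capelli_monomial n y y' [0..<m] x"

lemma capelli_split:
  assumes "z \<in> carrier_mat n n" "matrix_assignment n y" "matrix_assignment n y'" "matrix_assignment n x"
    and k: "k < m"
  shows "capelli n z y y' m x = capelli_prefix n z y y' k x * (x k * capelli_suffix n y y' m k x)"
proof -
  have c: "y k \<in> carrier_mat n n" "x k \<in> carrier_mat n n" "y' k \<in> carrier_mat n n"
    using assms by (auto simp: matrix_assignment_def)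
  note C = capelli_monomial_carrier[OF assms(2-4)]
  have D: "x k * (y' k * capelli_monomial n y y' l x) \<in> carrier_mat n n" for l
    by (intro mult_carrier_mat[OF c(2) mult_carrier_mat[OF c(3) C]])
  have "[0..<m] = [0..<k] @ k # [Suc k..<m]"
    using k upt_add_eq_append[of 0 k "m - k"] by (simp add: upt_conv_Cons)
  then show ?thesis
    unfolding capelli_def capelli_prefix_def capelli_suffix_def
    by (simp add: capelli_monomial_append[OF assms(2-4)]
       assoc_mult_mat[OF assms(1) mult_carrier_mat[OF C c(1)] D] assoc_mult_mat[OF C c(1) D])
qed

lemma capelli_carriers:
  assumes "z \<in> carrier_mat n n" "matrix_assignment n y" "matrix_assignment n y'" "matrix_assignment n x"
  shows "capelli_prefix n z y y' k x \<in> carrier_mat n n" "capelli_suffix n y y' m k x \<in> carrier_mat n n"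
    "capelli n z y y' m x \<in> carrier_mat n n"
  using assms capelli_monomial_carrier[OF assms(2-4)]
  by (auto simp: capelli_prefix_def capelli_suffix_def capelli_def matrix_assignment_def intro!: mult_carrier_mat[of _ n n])

lemma capelli_prefix_upd [simp]: "capelli_prefix n z y y' k (x(k := M)) = capelli_prefix n z y y' k x"
  unfolding capelli_prefix_def using capelli_monomial_cong[of "[0..<k]" "x(k := M)" x] by simp

lemma capelli_suffix_upd [simp]: "capelli_suffix n y y' m k (x(k := M)) = capelli_suffix n y y' m k x"
  unfolding capelli_suffix_def using capelli_monomial_cong[of "[Suc k..<m]" "x(k := M)" x] by simp

lemma mult3_mat_entry:
  assumes "A \<in> carrier_mat n n" "B \<in> carrier_mat n n" "C \<in> carrier_mat n n" "p < n" "q < n"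
  shows "(A * (B * C)) $$ (p, q) = (\<Sum>(a, b)\<in>{..<n} \<times> {..<n}. A $$ (p, a) * B $$ (a, b) * C $$ (b, q))"
proof -
  have "(A * (B * C)) $$ (p, q) = (\<Sum>a<n. A $$ (p, a) * (\<Sum>b<n. B $$ (a, b) * C $$ (b, q)))"
    using assms by (simp add: mult_mat_entry[of _ n] mult_carrier_mat[of _ n n] del: index_mult_mat)
  then show ?thesis
    by (simp add: sum_distrib_left mult.assoc sum.cartesian_product)
qed

text \<open>A matrix unit in place of \<open>x k\<close> decouples prefix and suffix into two scalar
  factors; this is what allows the two pieces to be interchanged.\<close>

lemma capelli_unit:
  assumes "z \<in> carrier_mat n n" "matrix_assignment n y" "matrix_assignment n y'" "matrix_assignment n x"
    and "k < m" "p < n" "q < n" "a < n" "b < n"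
  shows "capelli n z y y' m (x(k := matrix_unit n (a, b))) $$ (p, q) =
    capelli_prefix n z y y' k x $$ (p, a) * capelli_suffix n y y' m k x $$ (b, q)"
proof -
  let ?A = "capelli_prefix n z y y' k x" and ?B = "capelli_suffix n y y' m k x"
  let ?x = "x(k := matrix_unit n (a, b))"
  have "capelli n z y y' m ?x $$ (p, q) = (?A * (matrix_unit n (a, b) * ?B)) $$ (p, q)"
    using capelli_split[OF assms(1-3) matrix_assignment_upd[OF assms(4) matrix_unit_carrier] assms(5)] by simp
  also have "\<dots> = (\<Sum>(c, d)\<in>{..<n} \<times> {..<n}. ?A $$ (p, c) * matrix_unit n (a, b) $$ (c, d) * ?B $$ (d, q))"
    by (rule mult3_mat_entry) (use assms capelli_carriers[OF assms(1-4)] in auto)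
  also have "\<dots> = (\<Sum>j\<in>{..<n} \<times> {..<n}. if j = (a, b) then ?A $$ (p, a) * ?B $$ (b, q) else 0)"
    by (intro sum.cong refl) (auto split: if_splits)
  also have "\<dots> = ?A $$ (p, a) * ?B $$ (b, q)" using assms by (subst sum.delta) auto
  finally show ?thesis .
qed

lemma multilinear_capelli:
  assumes "z \<in> carrier_mat n n" "matrix_assignment n y" "matrix_assignment n y'" "p < n" "q < n"
  shows "multilinear n m (\<lambda>x. capelli n z y y' m x $$ (p, q))"
  unfolding multilinear_def
proof (intro allI impI)
  fix x :: "nat \<Rightarrow> 'a mat" and k assume x: "matrix_assignment n x" and k: "k < m"
  let ?A = "capelli_prefix n z y y' k x" and ?B = "capelli_suffix n y y' m k x"
  have "capelli n z y y' m x $$ (p, q) = (\<Sum>(a, b)\<in>{..<n} \<times> {..<n}. ?A $$ (p, a) * x k $$ (a, b) * ?B $$ (b, q))"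
    unfolding capelli_split[OF assms(1-3) x k]
    by (rule mult3_mat_entry) (use assms x capelli_carriers[OF assms(1-3) x] in \<open>auto simp: matrix_assignment_def\<close>)
  also have "\<dots> = (\<Sum>j\<in>{..<n} \<times> {..<n}. x k $$ j * capelli n z y y' m (x(k := matrix_unit n j)) $$ (p, q))"
    by (intro sum.cong refl) (auto simp: capelli_unit[OF assms(1-3) x k assms(4,5)] mult_ac)
  finally show "capelli n z y y' m x $$ (p, q) =
    (\<Sum>j\<in>{..<n} \<times> {..<n}. x k $$ j * capelli n z y y' m (x(k := matrix_unit n j)) $$ (p, q))" .
qed

section \<open>Alternation over the symmetric group\<close>

definition alternation :: "nat \<Rightarrow> ((nat \<Rightarrow> 'b) \<Rightarrow> 'a::comm_ring_1) \<Rightarrow> (nat \<Rightarrow> 'b) \<Rightarrow> 'a" where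
  "alternation m G x = (\<Sum>\<sigma> | \<sigma> permutes {..<m}. of_int (sign \<sigma>) * G (x \<circ> \<sigma>))"

lemma matrix_assignment_comp [simp]: "matrix_assignment n x \<Longrightarrow> matrix_assignment n (x \<circ> \<sigma>)"
  by (simp add: matrix_assignment_def)

lemma upd_comp_permutes:
  assumes "\<sigma> permutes S"
  shows "x(\<sigma> k := M) \<circ> \<sigma> = (x \<circ> \<sigma>)(k := M)"
  using permutes_inj[OF assms] by (auto simp: fun_eq_iff inj_eq)

lemma multilinear_alternation:
  assumes "multilinear n m G"
  shows "multilinear n m (alternation m G)"
  unfolding multilinear_def
proof (intro allI impI)
  fix x :: "nat \<Rightarrow> 'a mat" and i assume x: "matrix_assignment n x" and i: "i < m"
  let ?J = "{..<n} \<times> {..<n}" and ?E = "matrix_unit n :: _ \<Rightarrow> 'a mat"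
  have "of_int (sign \<sigma>) * G (x \<circ> \<sigma>) = (\<Sum>j\<in>?J. x i $$ j * (of_int (sign \<sigma>) * G (x(i := ?E j) \<circ> \<sigma>)))"
    if \<sigma>: "\<sigma> permutes {..<m}" for \<sigma>
  proof -
    \<comment> \<open>The argument \<open>x i\<close> occupies position \<open>k\<close> of the
      tuple permuted by \<sigma>.\<close>
    obtain k where k: "\<sigma> k = i" using surjD[OF permutes_surj[OF \<sigma>], of i] by metis
    then have "k < m" using i permutes_in_image[OF \<sigma>, of k] by simp
    then have "G (x \<circ> \<sigma>) = (\<Sum>j\<in>?J. (x \<circ> \<sigma>) k $$ j * G ((x \<circ> \<sigma>)(k := ?E j)))"
      using assms x unfolding multilinear_def by (metis matrix_assignment_comp)
    then show ?thesis
      using k upd_comp_permutes[OF \<sigma>, of x k] by (simp add: sum_distrib_left mult.left_commute)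
  qed
  then have "alternation m G x = (\<Sum>\<sigma> | \<sigma> permutes {..<m}. \<Sum>j\<in>?J. x i $$ j * (of_int (sign \<sigma>) * G (x(i := ?E j) \<circ> \<sigma>)))"
    unfolding alternation_def by (intro sum.cong) auto
  also have "\<dots> = (\<Sum>j\<in>?J. x i $$ j * alternation m G (x(i := ?E j)))"
    unfolding alternation_def sum_distrib_left by (rule sum.swap)
  finally show "alternation m G x = (\<Sum>j\<in>?J. x i $$ j * alternation m G (x(i := ?E j)))" .
qed

text \<open>Composing the summation index with the transposition permutes the summands and flips
  every sign.\<close>

lemma alternating_alternation: "alternating n m (alternation m G)"
  unfolding alternating_def
proof (intro allI impI)
  fix x :: "nat \<Rightarrow> 'a mat" and a b :: nat assume ab: "a < m" "b < m" "a \<noteq> b"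
  let ?\<tau> = "Transposition.transpose a b"
  have \<tau>: "?\<tau> permutes {..<m}" using ab by (intro permutes_swap_id) auto
  have "alternation m G x = (\<Sum>\<sigma> | \<sigma> permutes {..<m}. of_int (sign (?\<tau> \<circ> \<sigma>)) * G (x \<circ> (?\<tau> \<circ> \<sigma>)))"
    unfolding alternation_def by (rule setum_permutations_compose_left[OF \<tau>])
  also have "\<dots> = (\<Sum>\<sigma> | \<sigma> permutes {..<m}. - (of_int (sign \<sigma>) * G (x \<circ> ?\<tau> \<circ> \<sigma>)))"
  proof (intro sum.cong refl)
    fix \<sigma> assume "\<sigma> \<in> {\<sigma>. \<sigma> permutes {..<m}}"
    then have "permutation \<sigma>" "permutation ?\<tau>" using \<tau> by (auto simp: permutation_permutes)
    then have "sign (?\<tau> \<circ> \<sigma>) = - sign \<sigma>" using ab by (simp add: sign_compose sign_swap_id)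
    then show "of_int (sign (?\<tau> \<circ> \<sigma>)) * G (x \<circ> (?\<tau> \<circ> \<sigma>)) = - (of_int (sign \<sigma>) * G (x \<circ> ?\<tau> \<circ> \<sigma>))"
      by (simp add: comp_assoc)
  qed
  also have "\<dots> = - alternation m G (x \<circ> ?\<tau>)" by (simp add: alternation_def sum_negf)
  finally show "alternation m G (x \<circ> ?\<tau>) = - alternation m G x" by simp
qed

subsection \<open>Razmyslov's central polynomial\<close>

definition capelli_word :: "(nat \<Rightarrow> nat) \<Rightarrow> (nat \<Rightarrow> nat) \<Rightarrow> (nat \<Rightarrow> nat) \<Rightarrow> (nat \<Rightarrow> nat) \<Rightarrow> nat list \<Rightarrow> nat list" where
  "capelli_word X Y Y' \<sigma> l = concat (map (\<lambda>k. [Y k, X (\<sigma> k), Y' k]) l)"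

definition prefix_word where
  "prefix_word X Y Y' Z \<sigma> k = Z # capelli_word X Y Y' \<sigma> [0..<k] @ [Y k]"

text \<open>The alternating variable at the cut opens this word, whereas
  \<open>capelli_suffix\<close> starts only after it.\<close>

definition suffix_word where
  "suffix_word X Y Y' m \<sigma> k = X (\<sigma> k) # Y' k # capelli_word X Y Y' \<sigma> [Suc k..<m]"

text \<open>Razmyslov's transform: every monomial of the alternating polynomial is cut in front of an
  alternating variable, the two pieces are interchanged, and \<open>g\<close> is put between them.\<close>

definition razmyslov ::
  "(nat \<Rightarrow> nat) \<Rightarrow> (nat \<Rightarrow> nat) \<Rightarrow> (nat \<Rightarrow> nat) \<Rightarrow> nat \<Rightarrow> nat \<Rightarrow> 'a::comm_ring_1 ncpoly \<Rightarrow> 'a ncpoly" where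
  "razmyslov X Y Y' Z m g = (\<Sum>\<sigma> | \<sigma> permutes {..<m}. \<Sum>k<m.
     ncmult (Poly_Mapping.single (suffix_word X Y Y' m \<sigma> k) (of_int (sign \<sigma>)))
       (ncmult g (Poly_Mapping.single (prefix_word X Y Y' Z \<sigma> k) 1)))"

lemma word_eval_capelli_word:
  assumes "matrix_assignment n r"
  shows "word_eval n r (capelli_word X Y Y' \<sigma> l) = capelli_monomial n (r \<circ> Y) (r \<circ> Y') l (r \<circ> X \<circ> \<sigma>)"
  by (induction l) (simp_all add: capelli_word_def)

lemma word_eval_prefix_word:
  assumes "matrix_assignment n r"
  shows "word_eval n r (prefix_word X Y Y' Z \<sigma> k) = capelli_prefix n (r Z) (r \<circ> Y) (r \<circ> Y') k (r \<circ> X \<circ> \<sigma>)"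
proof -
  have "r (Y k) \<in> carrier_mat n n" using assms by (simp add: matrix_assignment_def)
  then show ?thesis using assms
    by (simp add: prefix_word_def capelli_prefix_def word_eval_append word_eval_capelli_word)
qed

lemma word_eval_suffix_word:
  assumes "matrix_assignment n r"
  shows "word_eval n r (suffix_word X Y Y' m \<sigma> k) =
    r (X (\<sigma> k)) * capelli_suffix n (r \<circ> Y) (r \<circ> Y') m k (r \<circ> X \<circ> \<sigma>)"
  using assms by (simp add: suffix_word_def capelli_suffix_def word_eval_capelli_word)

text \<open>Equivalently, inserting \<open>M\<close> in front of the alternating variables, one at a time, multiplies
  the alternating polynomial by \<open>n\<close> times the trace of \<open>M\<close>; the lemma is the case \<open>M = e_ab\<close>.\<close>

lemma alternation_capelli_trace:
  fixes z :: "'a::field_char_0 mat"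
  assumes z: "z \<in> carrier_mat n n" and y: "matrix_assignment n y" and y': "matrix_assignment n y'"
    and x: "matrix_assignment n x" and m: "m = n * n" and pq: "p < n" "q < n" and ab: "a < n" "b < n"
  shows "(\<Sum>\<sigma> | \<sigma> permutes {..<m}. \<Sum>k<m. of_int (sign \<sigma>) *
      (capelli_prefix n z y y' k (x \<circ> \<sigma>) $$ (p, a) * (x (\<sigma> k) * capelli_suffix n y y' m k (x \<circ> \<sigma>)) $$ (b, q)))
    = (if a = b then of_nat n * alternation m (\<lambda>x. capelli n z y y' m x $$ (p, q)) x else 0)"
    (is "?lhs = _")
proof -
  let ?G = "\<lambda>x. capelli n z y y' m x $$ (p, q)"
  let ?E = "matrix_unit n :: _ \<Rightarrow> 'a mat"
  \<comment> \<open>Row \<open>b\<close> of \<open>x (\<sigma> k)\<close> supplies the sum over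
    \<open>c\<close>. A prefix entry times a suffix entry is the Capelli entry with
    \<open>e_ac\<close> in position \<open>k\<close>, which is argument \<open>\<sigma> k\<close>
    before permuting.\<close>
  have summand: "of_int (sign \<sigma>) *
      (capelli_prefix n z y y' k (x \<circ> \<sigma>) $$ (p, a) * (x (\<sigma> k) * capelli_suffix n y y' m k (x \<circ> \<sigma>)) $$ (b, q))
    = (\<Sum>c<n. x (\<sigma> k) $$ (b, c) * (of_int (sign \<sigma>) * ?G (x(\<sigma> k := ?E (a, c)) \<circ> \<sigma>)))"
    if \<sigma>: "\<sigma> permutes {..<m}" and k: "k < m" for \<sigma> k
  proof -
    have x\<sigma>: "matrix_assignment n (x \<circ> \<sigma>)" using x by simp
    have "x (\<sigma> k) \<in> carrier_mat n n" using x by (simp add: matrix_assignment_def)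
    then have "(x (\<sigma> k) * capelli_suffix n y y' m k (x \<circ> \<sigma>)) $$ (b, q) =
      (\<Sum>c<n. x (\<sigma> k) $$ (b, c) * capelli_suffix n y y' m k (x \<circ> \<sigma>) $$ (c, q))"
      by (intro mult_mat_entry capelli_carriers(2)[OF z y y' x\<sigma>] ab pq)
    moreover have "?G (x(\<sigma> k := ?E (a, c)) \<circ> \<sigma>) =
      capelli_prefix n z y y' k (x \<circ> \<sigma>) $$ (p, a) * capelli_suffix n y y' m k (x \<circ> \<sigma>) $$ (c, q)" if "c < n" for c
      unfolding upd_comp_permutes[OF \<sigma>]
      using capelli_unit[OF z y y' x\<sigma> k pq ab(1) that] .
    ultimately show ?thesis by (simp add: sum_distrib_left mult_ac del: index_mult_mat)
  qed
  have "?lhs = (\<Sum>\<sigma> | \<sigma> permutes {..<m}. \<Sum>k<m. \<Sum>c<n.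
      x (\<sigma> k) $$ (b, c) * (of_int (sign \<sigma>) * ?G (x(\<sigma> k := ?E (a, c)) \<circ> \<sigma>)))"
    by (intro sum.cong refl summand) auto
  \<comment> \<open>Reindexing by \<open>i = \<sigma> k\<close> makes the replaced argument
    independent of \<sigma>, so that the sum over \<sigma> becomes an alternation.\<close>
  also have "\<dots> = (\<Sum>\<sigma> | \<sigma> permutes {..<m}. \<Sum>i<m. \<Sum>c<n.
      x i $$ (b, c) * (of_int (sign \<sigma>) * ?G (x(i := ?E (a, c)) \<circ> \<sigma>)))"
  proof (rule sum.cong[OF refl])
    fix \<sigma> assume "\<sigma> \<in> {\<sigma>. \<sigma> permutes {..<m}}"
    then have "bij_betw \<sigma> {..<m} {..<m}" by (simp add: permutes_imp_bij)
    then show "(\<Sum>k<m. \<Sum>c<n. x (\<sigma> k) $$ (b, c) * (of_int (sign \<sigma>) * ?G (x(\<sigma> k := ?E (a, c)) \<circ> \<sigma>)))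
      = (\<Sum>i<m. \<Sum>c<n. x i $$ (b, c) * (of_int (sign \<sigma>) * ?G (x(i := ?E (a, c)) \<circ> \<sigma>)))"
      by (rule sum.reindex_bij_betw)
  qed
  also have "\<dots> = (\<Sum>i<m. \<Sum>\<sigma> | \<sigma> permutes {..<m}. \<Sum>c<n.
      x i $$ (b, c) * (of_int (sign \<sigma>) * ?G (x(i := ?E (a, c)) \<circ> \<sigma>)))"
    by (rule sum.swap)
  also have "\<dots> = (\<Sum>i<m. \<Sum>c<n. \<Sum>\<sigma> | \<sigma> permutes {..<m}.
      x i $$ (b, c) * (of_int (sign \<sigma>) * ?G (x(i := ?E (a, c)) \<circ> \<sigma>)))"
    by (intro sum.cong refl sum.swap)
  also have "\<dots> = (\<Sum>c<n. \<Sum>i<m. \<Sum>\<sigma> | \<sigma> permutes {..<m}.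
      x i $$ (b, c) * (of_int (sign \<sigma>) * ?G (x(i := ?E (a, c)) \<circ> \<sigma>)))"
    by (rule sum.swap)
  also have "\<dots> = (\<Sum>c<n. \<Sum>i<m. x i $$ (b, c) * alternation m ?G (x(i := ?E (a, c))))"
    by (simp add: alternation_def sum_distrib_left)
  \<comment> \<open>Cramer's rule for the positions \<open>(a, c)\<close> and \<open>(b, c)\<close>:
    every \<open>c\<close> contributes when \<open>a = b\<close>, whence the factor
    \<open>n\<close>.\<close>
  also have "\<dots> = (\<Sum>c<n. if (a, c) = (b, c) then alternation m ?G x else 0)"
    unfolding m using ab
    by (intro sum.cong refl alternating_cramer[OF multilinear_alternation[OF multilinear_capelli[OF z y y' pq]]
          alternating_alternation _ _ x]) auto
  also have "\<dots> = (if a = b then of_nat n * alternation m ?G x else 0)" by simp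
  finally show ?thesis .
qed

text \<open>Entry \<open>(b, a)\<close> of \<open>S g P\<close> is the sum of
  \<open>S_bq g_qp P_pa\<close>. Summing over \<sigma> and the cuts \<open>k\<close>, the preceding
  lemma turns \<open>P_pa S_bq\<close> into \<open>n F_pq\<close> if \<open>a = b\<close> and into 0
  otherwise, where \<open>F\<close> is the value of the Capelli polynomial. The total is
  \<open>n tr (F g)\<close> times the identity.\<close>

lemma nc_eval_razmyslov:
  fixes r :: "nat \<Rightarrow> 'a::field_char_0 mat"
  assumes r: "matrix_assignment n r" and ba: "b < n" "a < n"
  shows "nc_eval n r (razmyslov X Y Y' Z (n * n) g) $$ (b, a) = (if a = b then
    (\<Sum>(q, p)\<in>{..<n} \<times> {..<n}. (of_nat n * alternation (n * n)
      (\<lambda>x. capelli n (r Z) (r \<circ> Y) (r \<circ> Y') (n * n) x $$ (p, q)) (r \<circ> X)) * nc_eval n r g $$ (q, p)) else 0)"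
proof -
  let ?m = "n * n" and ?x = "r \<circ> X" and ?J = "{..<n} \<times> {..<n}"
  let ?P = "\<lambda>\<sigma> k. capelli_prefix n (r Z) (r \<circ> Y) (r \<circ> Y') k (?x \<circ> \<sigma>)"
  let ?S = "\<lambda>\<sigma> k. ?x (\<sigma> k) * capelli_suffix n (r \<circ> Y) (r \<circ> Y') ?m k (?x \<circ> \<sigma>)"
  let ?F = "\<lambda>p q. alternation ?m (\<lambda>x. capelli n (r Z) (r \<circ> Y) (r \<circ> Y') ?m x $$ (p, q)) ?x"
  have z: "r Z \<in> carrier_mat n n" using r by (simp add: matrix_assignment_def)
  have y: "matrix_assignment n (r \<circ> Y)" "matrix_assignment n (r \<circ> Y')" "matrix_assignment n ?x" using r by simp_all
  have single: "nc_eval n r (Poly_Mapping.single w c) = c \<cdot>\<^sub>m word_eval n r w" for w c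
    using word_eval_carrier[OF r, of w] by (intro eq_matI) (auto simp: nc_eval_single)
  have summand: "nc_eval n r (ncmult (Poly_Mapping.single (suffix_word X Y Y' ?m \<sigma> k) (of_int (sign \<sigma>)))
       (ncmult g (Poly_Mapping.single (prefix_word X Y Y' Z \<sigma> k) 1))) $$ (b, a)
    = (\<Sum>(q, p)\<in>?J. nc_eval n r g $$ (q, p) * (of_int (sign \<sigma>) * (?P \<sigma> k $$ (p, a) * ?S \<sigma> k $$ (b, q))))" for \<sigma> k
  proof -
    have P: "?P \<sigma> k \<in> carrier_mat n n" by (rule capelli_carriers(1)[OF z y(1,2) matrix_assignment_comp[OF y(3)]])
    have S: "?S \<sigma> k \<in> carrier_mat n n"
      using y(3) capelli_carriers(2)[OF z y(1,2) matrix_assignment_comp[OF y(3)]]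
      by (intro mult_carrier_mat[of _ n n]) (auto simp: matrix_assignment_def)
    let ?h = "ncmult (Poly_Mapping.single (suffix_word X Y Y' ?m \<sigma> k) (of_int (sign \<sigma>)))
       (ncmult g (Poly_Mapping.single (prefix_word X Y Y' Z \<sigma> k) 1))"
    have h: "nc_eval n r ?h = (of_int (sign \<sigma>) \<cdot>\<^sub>m ?S \<sigma> k) * (nc_eval n r g * (1 \<cdot>\<^sub>m ?P \<sigma> k))"
      by (simp add: nc_eval_mult[OF r] single word_eval_prefix_word[OF r] word_eval_suffix_word[OF r])
    have "nc_eval n r ?h $$ (b, a) = (\<Sum>(q, p)\<in>?J. (of_int (sign \<sigma>) \<cdot>\<^sub>m ?S \<sigma> k) $$ (b, q) * nc_eval n r g $$ (q, p) * (1 \<cdot>\<^sub>m ?P \<sigma> k) $$ (p, a))"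
      unfolding h by (rule mult3_mat_entry) (use P S ba in auto)
    also have "\<dots> = (\<Sum>(q, p)\<in>?J. nc_eval n r g $$ (q, p) * (of_int (sign \<sigma>) * (?P \<sigma> k $$ (p, a) * ?S \<sigma> k $$ (b, q))))"
    proof (rule sum.cong[OF refl])
      fix j assume "j \<in> ?J"
      then obtain q p where j: "j = (q, p)" "q < n" "p < n" by auto
      have "(of_int (sign \<sigma>) \<cdot>\<^sub>m ?S \<sigma> k) $$ (b, q) = of_int (sign \<sigma>) * ?S \<sigma> k $$ (b, q)"
        by (rule index_smult_mat(1)) (use ba j carrier_matD[OF S] in simp_all)
      moreover have "(1 \<cdot>\<^sub>m ?P \<sigma> k) $$ (p, a) = 1 * ?P \<sigma> k $$ (p, a)"
        by (rule index_smult_mat(1)) (use ba j carrier_matD[OF P] in simp_all)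
      ultimately show "(case j of (q, p) \<Rightarrow> (of_int (sign \<sigma>) \<cdot>\<^sub>m ?S \<sigma> k) $$ (b, q) * nc_eval n r g $$ (q, p) * (1 \<cdot>\<^sub>m ?P \<sigma> k) $$ (p, a))
        = (case j of (q, p) \<Rightarrow> nc_eval n r g $$ (q, p) * (of_int (sign \<sigma>) * (?P \<sigma> k $$ (p, a) * ?S \<sigma> k $$ (b, q))))"
        by (simp only: j prod.case mult_1_left mult_ac)
    qed
    finally show ?thesis .
  qed
  have "nc_eval n r (razmyslov X Y Y' Z ?m g) $$ (b, a) = (\<Sum>\<sigma> | \<sigma> permutes {..<?m}. \<Sum>k<?m. \<Sum>j\<in>?J.
      case j of (q, p) \<Rightarrow> nc_eval n r g $$ (q, p) * (of_int (sign \<sigma>) * (?P \<sigma> k $$ (p, a) * ?S \<sigma> k $$ (b, q))))"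
    unfolding razmyslov_def nc_eval_sum[OF ba] summand ..
  also have "\<dots> = (\<Sum>\<sigma> | \<sigma> permutes {..<?m}. \<Sum>j\<in>?J. \<Sum>k<?m.
      case j of (q, p) \<Rightarrow> nc_eval n r g $$ (q, p) * (of_int (sign \<sigma>) * (?P \<sigma> k $$ (p, a) * ?S \<sigma> k $$ (b, q))))"
    by (intro sum.cong refl sum.swap)
  also have "\<dots> = (\<Sum>j\<in>?J. \<Sum>\<sigma> | \<sigma> permutes {..<?m}. \<Sum>k<?m.
      case j of (q, p) \<Rightarrow> nc_eval n r g $$ (q, p) * (of_int (sign \<sigma>) * (?P \<sigma> k $$ (p, a) * ?S \<sigma> k $$ (b, q))))"
    by (rule sum.swap)
  also have "\<dots> = (\<Sum>(q, p)\<in>?J. if a = b then (of_nat n * ?F p q) * nc_eval n r g $$ (q, p) else 0)"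
  proof (rule sum.cong[OF refl])
    fix j assume "j \<in> ?J"
    then obtain q p where j: "j = (q, p)" "q < n" "p < n" by auto
    have "(\<Sum>\<sigma> | \<sigma> permutes {..<?m}. \<Sum>k<?m. of_int (sign \<sigma>) * (?P \<sigma> k $$ (p, a) * ?S \<sigma> k $$ (b, q)))
      = (if a = b then of_nat n * ?F p q else 0)"
      by (rule alternation_capelli_trace[OF z y refl j(3,2) ba(2,1)])
    then show "(\<Sum>\<sigma> | \<sigma> permutes {..<?m}. \<Sum>k<?m.
      case j of (q, p) \<Rightarrow> nc_eval n r g $$ (q, p) * (of_int (sign \<sigma>) * (?P \<sigma> k $$ (p, a) * ?S \<sigma> k $$ (b, q))))
      = (case j of (q, p) \<Rightarrow> if a = b then (of_nat n * ?F p q) * nc_eval n r g $$ (q, p) else 0)"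
      by (simp only: j prod.case sum_distrib_left[symmetric]) simp
  qed
  finally show ?thesis by (cases "a = b") simp_all
qed

section \<open>Matrix units at which the Capelli polynomial does not vanish\<close>

lemma matrix_unit_mult_entry:
  assumes "A \<in> carrier_mat n n" "a < n" "b < n" "i < n" "j < n"
  shows "(matrix_unit n (a, b) * A) $$ (i, j) = (if i = a then A $$ (b, j) else 0)"
proof -
  have "(matrix_unit n (a, b) * A) $$ (i, j) = (\<Sum>k<n. matrix_unit n (a, b) $$ (i, k) * A $$ (k, j))"
    by (rule mult_mat_entry) (use assms in auto)
  also have "\<dots> = (\<Sum>k<n. if k = b then (if i = a then A $$ (b, j) else 0) else 0)"
    using assms by (intro sum.cong) (auto split: if_splits)
  also have "\<dots> = (if i = a then A $$ (b, j) else 0)" using assms by simp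
  finally show ?thesis .
qed

text \<open>An index \<open>k < n * n\<close> encodes the position
  \<open>(k div n, k mod n)\<close>. The block of \<open>k\<close> is the unit at
  \<open>(p0, p0)\<close> when \<sigma> fixes \<open>k\<close>; otherwise some inner indices
  mismatch and the block is 0.\<close>

lemma capelli_monomial_units:
  assumes n: "p0 < n" and l: "set l \<subseteq> {..<n * n}" and \<sigma>: "\<sigma> permutes {..<n * n}" and q: "q < n"
  shows "capelli_monomial n (\<lambda>k. matrix_unit n (p0, k div n)) (\<lambda>k. matrix_unit n (k mod n, p0)) l
      ((\<lambda>k. matrix_unit n (k div n, k mod n)) \<circ> \<sigma>) $$ (p0, q)
    = (if (\<forall>k\<in>set l. \<sigma> k = k) \<and> q = p0 then 1 else (0 :: 'a::comm_ring_1))"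
  using l
proof (induction l)
  case Nil
  then show ?case using n q by auto
next
  case (Cons k l)
  let ?y = "\<lambda>k. matrix_unit n (p0, k div n) :: 'a mat" and ?y' = "\<lambda>k. matrix_unit n (k mod n, p0) :: 'a mat"
  let ?x = "(\<lambda>k. matrix_unit n (k div n, k mod n) :: 'a mat) \<circ> \<sigma>"
  have bounds: "i div n < n" "i mod n < n" if "i < n * n" for i
    using that n by (auto simp: less_mult_imp_div_less)
  have k: "k < n * n" "\<sigma> k < n * n" using Cons.prems permutes_in_image[OF \<sigma>, of k] by auto
  let ?M = "capelli_monomial n ?y ?y' l ?x"
  have M: "?M \<in> carrier_mat n n" by (rule capelli_monomial_carrier) (simp_all add: matrix_assignment_def)
  have M': "?y' k * ?M \<in> carrier_mat n n" "?x k * (?y' k * ?M) \<in> carrier_mat n n"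
    using M by (auto intro!: mult_carrier_mat[of _ n n])
  have "capelli_monomial n ?y ?y' (k # l) ?x $$ (p0, q) = (?x k * (?y' k * ?M)) $$ (k div n, q)"
    using matrix_unit_mult_entry[OF M'(2) n bounds(1)[OF k(1)] n q] by simp
  also have "\<dots> = (if k div n = \<sigma> k div n then (?y' k * ?M) $$ (\<sigma> k mod n, q) else 0)"
    using matrix_unit_mult_entry[OF M'(1) bounds[OF k(2)] bounds(1)[OF k(1)] q] by simp
  also have "(?y' k * ?M) $$ (\<sigma> k mod n, q) = (if \<sigma> k mod n = k mod n then ?M $$ (p0, q) else 0)"
    using matrix_unit_mult_entry[OF M bounds(2)[OF k(1)] n bounds(2)[OF k(2)] q] by simp
  \<comment> \<open>Quotient and remainder together determine the index, so both matches amount to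
    \<open>\<sigma> k = k\<close>.\<close>
  also have "(if k div n = \<sigma> k div n then (if \<sigma> k mod n = k mod n then ?M $$ (p0, q) else 0) else 0) =
    (if \<sigma> k = k then ?M $$ (p0, q) else 0)"
    using div_mult_mod_eq[of k n] div_mult_mod_eq[of "\<sigma> k" n] by metis
  finally have step: "capelli_monomial n ?y ?y' (k # l) ?x $$ (p0, q) = (if \<sigma> k = k then ?M $$ (p0, q) else 0)" .
  have "?M $$ (p0, q) = (if (\<forall>k\<in>set l. \<sigma> k = k) \<and> q = p0 then 1 else 0)"
    using Cons.prems by (intro Cons.IH) simp
  then show ?case unfolding step by (cases "\<sigma> k = k") simp_all
qed

text \<open>Only the identity permutation survives, with sign 1, and the leading factor moves the
  unit at \<open>(p0, p0)\<close> to \<open>(q0, p0)\<close>.\<close>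

lemma alternation_capelli_units:
  assumes "p0 < n" "q0 < n" "p < n" "q < n"
  shows "alternation (n * n) (\<lambda>x. capelli n (matrix_unit n (q0, p0)) (\<lambda>k. matrix_unit n (p0, k div n))
      (\<lambda>k. matrix_unit n (k mod n, p0)) (n * n) x $$ (p, q)) (\<lambda>k. matrix_unit n (k div n, k mod n))
    = (if (p, q) = (q0, p0) then 1 else (0 :: 'a::comm_ring_1))"
proof -
  let ?m = "n * n"
  let ?y = "\<lambda>k. matrix_unit n (p0, k div n) :: 'a mat" and ?y' = "\<lambda>k. matrix_unit n (k mod n, p0) :: 'a mat"
  let ?x = "\<lambda>k. matrix_unit n (k div n, k mod n) :: 'a mat"
  have "capelli n (matrix_unit n (q0, p0)) ?y ?y' ?m (?x \<circ> \<sigma>) $$ (p, q) =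
    (if \<sigma> = id then (if (p, q) = (q0, p0) then 1 else 0) else 0)" if \<sigma>: "\<sigma> permutes {..<?m}" for \<sigma>
  proof -
    have "(\<forall>k\<in>set [0..<?m]. \<sigma> k = k) \<longleftrightarrow> \<sigma> = id"
      using permutes_not_in[OF \<sigma>] by (fastforce simp: fun_eq_iff)
    then have *: "capelli_monomial n ?y ?y' [0..<?m] (?x \<circ> \<sigma>) $$ (p0, q) = (if \<sigma> = id \<and> q = p0 then 1 else 0)"
      by (subst capelli_monomial_units[OF assms(1) _ \<sigma> assms(4)]) auto
    have M: "capelli_monomial n ?y ?y' [0..<?m] (?x \<circ> \<sigma>) \<in> carrier_mat n n"
      by (rule capelli_monomial_carrier) (simp_all add: matrix_assignment_def)
    show ?thesis
      unfolding capelli_def matrix_unit_mult_entry[OF M assms(2,1,3,4)] * by auto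
  qed
  then have "alternation ?m (\<lambda>x. capelli n (matrix_unit n (q0, p0)) ?y ?y' ?m x $$ (p, q)) ?x =
    (\<Sum>\<sigma> | \<sigma> permutes {..<?m}. if \<sigma> = id then (if (p, q) = (q0, p0) then 1 else 0) else 0)"
    unfolding alternation_def by (intro sum.cong) auto
  also have "\<dots> = (if (p, q) = (q0, p0) then 1 else 0)"
    by (subst sum.delta) (auto simp: finite_permutations permutes_id)
  finally show ?thesis .
qed

text \<open>\<open>Q\<close> is Razmyslov's transform in variables absent from \<open>f\<close>,
  which can be set to matrix units while \<open>f\<close> keeps a nonzero value. The weights
  \<open>K\<close> depend on the assignment only, so the scalar value of \<open>Q g\<close> is
  linear in the value of \<open>g\<close>.\<close>

lemma razmyslov_operator:
  fixes f :: "'a::field_char_0 ncpoly"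
  assumes "\<not> poly_identity n f"
  obtains Q :: "'a ncpoly \<Rightarrow> 'a ncpoly" and K where
    "\<And>r g a b. matrix_assignment n r \<Longrightarrow> a < n \<Longrightarrow> b < n \<Longrightarrow> nc_eval n r (Q g) $$ (b, a) =
      (if a = b then (\<Sum>j\<in>{..<n} \<times> {..<n}. K r j * nc_eval n r g $$ j) else 0)"
    "\<not> poly_identity n (Q f)"
proof -
  obtain r0 where r0: "matrix_assignment n r0" "nc_eval n r0 f \<noteq> 0\<^sub>m n n"
    using assms by (auto simp: poly_identity_def)
  then obtain p0 q0 where pq0: "p0 < n" "q0 < n" "nc_eval n r0 f $$ (p0, q0) \<noteq> 0"
    by (metis eq_matI index_zero_mat nc_eval_dim)
  have "finite (\<Union>w\<in>Poly_Mapping.keys f. set w)" by simp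
  then obtain N where "\<forall>v\<in>(\<Union>w\<in>Poly_Mapping.keys f. set w). v < N"
    by (metis finite_nat_set_iff_bounded)
  then have N: "v < N" if "w \<in> Poly_Mapping.keys f" "v \<in> set w" for v w using that by blast
  let ?m = "n * n"
  \<comment> \<open>Residues modulo 4 beyond the bound \<open>N\<close> keep the fresh variables
    distinct from each other and from the variables of \<open>f\<close>.\<close>
  define X where "X i = N + 4 * i" for i :: nat
  define Y where "Y i = N + 4 * i + 1" for i :: nat
  define Y' where "Y' i = N + 4 * i + 2" for i :: nat
  define Z where "Z = N + 3"
  define Q :: "'a ncpoly \<Rightarrow> 'a ncpoly" where "Q = razmyslov X Y Y' Z ?m"
  define K where "K r = (\<lambda>(q, p). of_nat n * alternation ?m
      (\<lambda>x. capelli n (r Z) (r \<circ> Y) (r \<circ> Y') ?m x $$ (p, q)) (r \<circ> X))" for r :: "nat \<Rightarrow> 'a mat"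
  have Q: "nc_eval n r (Q g) $$ (b, a) =
      (if a = b then (\<Sum>j\<in>{..<n} \<times> {..<n}. K r j * nc_eval n r g $$ j) else 0)"
    if "matrix_assignment n r" "a < n" "b < n" for r g a b
    unfolding Q_def K_def nc_eval_razmyslov[OF that(1,3,2)] by (simp add: case_prod_unfold)
  \<comment> \<open>Agrees with \<open>r0\<close> on the variables of \<open>f\<close> and puts the
    matrix units of the preceding lemma on the fresh ones.\<close>
  define r where "r v = (let i = (v - N) div 4 in if v < N then r0 v
      else if (v - N) mod 4 = 0 then matrix_unit n (i div n, i mod n)
      else if (v - N) mod 4 = 1 then matrix_unit n (p0, i div n)
      else if (v - N) mod 4 = 2 then matrix_unit n (i mod n, p0)
      else matrix_unit n (q0, p0))" for v
  have r: "matrix_assignment n r"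
    using r0(1) by (auto simp: matrix_assignment_def r_def Let_def)
  have "(4 * i + 1) div 4 = i" "(4 * i + 2) div 4 = i" "(4 * i + 1) mod 4 = 1" "(4 * i + 2) mod 4 = 2" for i :: nat
    by presburger+
  then have r_vars: "r \<circ> X = (\<lambda>i. matrix_unit n (i div n, i mod n))" "r \<circ> Y = (\<lambda>i. matrix_unit n (p0, i div n))"
    "r \<circ> Y' = (\<lambda>i. matrix_unit n (i mod n, p0))" "r Z = matrix_unit n (q0, p0)"
    by (simp_all add: fun_eq_iff r_def X_def Y_def Y'_def Z_def Let_def del: add_2_eq_Suc')
  have f_r: "nc_eval n r f = nc_eval n r0 f"
    by (rule nc_eval_cong) (use N in \<open>auto simp: r_def\<close>)
  \<comment> \<open>The Capelli value is the unit at \<open>(q0, p0)\<close>; its trace pairing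
    reads off the entry \<open>(p0, q0)\<close>, where \<open>f\<close> is nonzero at
    \<open>r0\<close>. The factor \<open>n\<close> is harmless in characteristic 0.\<close>
  have K_r: "K r j = (if j = (p0, q0) then of_nat n else 0)" if j: "j \<in> {..<n} \<times> {..<n}" for j
  proof -
    obtain q p where qp: "j = (q, p)" "q < n" "p < n" using j by auto
    show ?thesis
      unfolding K_def r_vars qp(1) prod.case alternation_capelli_units[OF pq0(1,2) qp(3,2)] by simp
  qed
  have "nc_eval n r (Q f) $$ (p0, p0) = (\<Sum>j\<in>{..<n} \<times> {..<n}. K r j * nc_eval n r f $$ j)"
    using Q[OF r pq0(1) pq0(1)] by simp
  also have "\<dots> = (\<Sum>j\<in>{..<n} \<times> {..<n}. if j = (p0, q0) then of_nat n * nc_eval n r0 f $$ (p0, q0) else 0)"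
    by (intro sum.cong refl) (simp add: K_r f_r)
  also have "\<dots> = of_nat n * nc_eval n r0 f $$ (p0, q0)" using pq0 by (subst sum.delta) auto
  also have "\<dots> \<noteq> 0" using pq0 by simp
  finally have "nc_eval n r (Q f) \<noteq> 0\<^sub>m n n" using pq0(1) by auto
  then have "\<not> poly_identity n (Q f)" using r by (auto simp: poly_identity_def)
  then show thesis using that[OF Q] by blast
qed

subsection \<open>Elimination\<close>

lemma locally_lin_dependent_imp_central_relation:
  fixes f :: "nat \<Rightarrow> 'a::field_char_0 ncpoly"
  assumes n: "n \<ge> 1" and dep: "locally_lin_dependent n t f"
  shows "\<exists>c. (\<forall>i<t. central_poly n (c i)) \<and> (\<exists>i<t. \<not> poly_identity n (c i)) \<and>
    poly_identity n (\<Sum>i<t. ncmult (c i) (f i))"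
  using dep
proof (induction t arbitrary: f)
  case 0
  \<comment> \<open>With no polynomials there is no nonzero coefficient, so a single assignment,
    here the zero one, contradicts the hypothesis.\<close>
  have "matrix_assignment n (\<lambda>_. 0\<^sub>m n n :: 'a mat)" by (simp add: matrix_assignment_def)
  then show ?case using 0 by (auto simp: locally_lin_dependent_def mats_lin_dependent_def)
next
  case (Suc t)
  have n0: "0 < n" using n by simp
  show ?case
  proof (cases "poly_identity n (f t)")
    case True
    \<comment> \<open>Coefficient 1 at \<open>t\<close> and 0 elsewhere; the empty word carries the
      constant 1.\<close>
    define c :: "nat \<Rightarrow> 'a ncpoly" where "c i = (if i = t then Poly_Mapping.single [] 1 else 0)" for i
    have c: "nc_eval n r (c i) = (if i = t then 1 else 0) \<cdot>\<^sub>m 1\<^sub>m n" for r i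
      by (rule eq_matI) (auto simp: c_def nc_eval_single nc_eval_zero)
    have "central_poly n (c i)" for i using c unfolding central_poly_def by blast
    moreover have "\<not> poly_identity n (c t)"
    proof
      assume "poly_identity n (c t)"
      then have "nc_eval n (\<lambda>_. 0\<^sub>m n n) (c t) = 0\<^sub>m n n"
        by (simp add: poly_identity_def matrix_assignment_def)
      then have "(1 \<cdot>\<^sub>m 1\<^sub>m n :: 'a mat) $$ (0, 0) = 0\<^sub>m n n $$ (0, 0)" by (simp add: c)
      then show False using n0 by simp
    qed
    moreover have "poly_identity n (\<Sum>i<Suc t. ncmult (c i) (f i))"
      unfolding poly_identity_def
    proof (intro allI impI eq_matI)
      fix r :: "nat \<Rightarrow> 'a mat" and i j
      assume r: "matrix_assignment n r" and "i < dim_row (0\<^sub>m n n :: 'a mat)" "j < dim_col (0\<^sub>m n n :: 'a mat)"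
      then have ij: "i < n" "j < n" by simp_all
      have "nc_eval n r (f t) = 0\<^sub>m n n" using True r by (simp add: poly_identity_def)
      then show "nc_eval n r (\<Sum>i<Suc t. ncmult (c i) (f i)) $$ (i, j) = 0\<^sub>m n n $$ (i, j)"
        unfolding nc_eval_sum[OF ij] nc_eval_mult_scalar[OF r c ij] using ij by simp
    qed simp_all
    ultimately show ?thesis by blast
  next
    case False
    obtain Q :: "'a ncpoly \<Rightarrow> 'a ncpoly" and K where
      Q: "\<And>r g a b. matrix_assignment n r \<Longrightarrow> a < n \<Longrightarrow> b < n \<Longrightarrow> nc_eval n r (Q g) $$ (b, a) =
        (if a = b then (\<Sum>j\<in>{..<n} \<times> {..<n}. K r j * nc_eval n r g $$ j) else 0)"
      and Qft: "\<not> poly_identity n (Q (f t))"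
      using razmyslov_operator[OF False] by blast
    \<comment> \<open>The scalar value of \<open>Q g\<close> at \<open>r\<close>. Being linear in
      the value of \<open>g\<close> there, it inherits every linear relation among such
      values.\<close>
    define L where "L r g = (\<Sum>j\<in>{..<n} \<times> {..<n}. K r j * nc_eval n r g $$ j)" for r g
    have Q_eval: "nc_eval n r (Q g) = L r g \<cdot>\<^sub>m 1\<^sub>m n" if "matrix_assignment n r" for r g
      by (rule eq_matI) (auto simp: Q[OF that] L_def)
    have Q_central: "central_poly n (Q g)" for g
      using Q_eval unfolding central_poly_def by blast
    note Q_mult = nc_eval_mult_scalar[OF _ Q_eval]
    define g where "g i = ncmult (Q (f t)) (f i) - ncmult (Q (f i)) (f t)" for i
    have g_eval: "nc_eval n r (g k) $$ (i, j) =
        L r (f t) * nc_eval n r (f k) $$ (i, j) - L r (f k) * nc_eval n r (f t) $$ (i, j)"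
      if "matrix_assignment n r" "i < n" "j < n" for r k i j
      using that by (simp add: g_def nc_eval_diff Q_mult)
    \<comment> \<open>An index below \<open>t\<close> is needed for a nontrivial relation when all
      \<open>g k\<close> vanish at a point. If \<open>t = 0\<close>, dependence of the single
      \<open>f t\<close> would make it an identity.\<close>
    have t0: "0 < t"
    proof (rule ccontr)
      assume "\<not> 0 < t"
      have "poly_identity n (f t)"
        unfolding poly_identity_def
      proof (intro allI impI)
        fix r :: "nat \<Rightarrow> 'a mat" assume "matrix_assignment n r"
        then have "mats_lin_dependent n (Suc 0) (\<lambda>i. nc_eval n r (f i))"
          using Suc.prems \<open>\<not> 0 < t\<close> by (simp add: locally_lin_dependent_def)
        then obtain a where a: "a (0::nat) \<noteq> 0" "mat n n (\<lambda>(i, j). a 0 * nc_eval n r (f 0) $$ (i, j)) = 0\<^sub>m n n"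
          by (auto simp: mats_lin_dependent_def)
        have "nc_eval n r (f 0) $$ (i, j) = 0" if "i < n" "j < n" for i j
          using arg_cong[OF a(2), of "\<lambda>M. M $$ (i, j)"] that a(1) by simp
        then show "nc_eval n r (f t) = 0\<^sub>m n n"
          using \<open>\<not> 0 < t\<close> by (intro eq_matI) auto
      qed
      then show False using False by simp
    qed
    have "locally_lin_dependent n t g"
      unfolding locally_lin_dependent_def
    proof (intro allI impI)
      fix r :: "nat \<Rightarrow> 'a mat" assume r: "matrix_assignment n r"
      then have "mats_lin_dependent n (Suc t) (\<lambda>i. nc_eval n r (f i))"
        using Suc.prems by (simp add: locally_lin_dependent_def)
      then obtain a where a: "\<exists>i<Suc t. a i \<noteq> 0"
          "mat n n (\<lambda>(i, j). \<Sum>k<Suc t. a k * nc_eval n r (f k) $$ (i, j)) = 0\<^sub>m n n"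
        unfolding mats_lin_dependent_def by blast
      have rel: "(\<Sum>k<t. a k * nc_eval n r (f k) $$ (i, j)) = - (a t * nc_eval n r (f t) $$ (i, j))"
        if "i < n" "j < n" for i j
        using arg_cong[OF a(2), of "\<lambda>M. M $$ (i, j)"] that by (simp add: eq_neg_iff_add_eq_0)
      have "(\<Sum>k<t. a k * L r (f k)) = (\<Sum>j\<in>{..<n} \<times> {..<n}. K r j * (\<Sum>k<t. a k * nc_eval n r (f k) $$ j))"
        unfolding L_def sum_distrib_left by (subst sum.swap) (simp add: mult.left_commute)
      also have "\<dots> = (\<Sum>j\<in>{..<n} \<times> {..<n}. K r j * (- (a t * nc_eval n r (f t) $$ j)))"
        by (intro sum.cong refl) (auto simp: rel)
      also have "\<dots> = - (a t * L r (f t))"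
        by (simp add: L_def sum_distrib_left sum_negf mult.left_commute)
      finally have relL: "(\<Sum>k<t. a k * L r (f k)) = - (a t * L r (f t))" .
      have relg: "(\<Sum>k<t. a k * nc_eval n r (g k) $$ (i, j)) = 0" if "i < n" "j < n" for i j
      proof -
        have "(\<Sum>k<t. a k * nc_eval n r (g k) $$ (i, j)) =
          L r (f t) * (\<Sum>k<t. a k * nc_eval n r (f k) $$ (i, j)) - (\<Sum>k<t. a k * L r (f k)) * nc_eval n r (f t) $$ (i, j)"
          by (simp add: g_eval[OF r that] right_diff_distrib sum_subtractf sum_distrib_left sum_distrib_right mult_ac)
        then show ?thesis by (simp add: rel[OF that] relL mult_ac)
      qed
      show "mats_lin_dependent n t (\<lambda>i. nc_eval n r (g i))"
      \<comment> \<open>The same coefficients serve unless only \<open>a t\<close> is nonzero. In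
        that case \<open>f t\<close> vanishes at \<open>r\<close>, hence so do
        \<open>L r (f t)\<close> and every \<open>g k\<close>, and all coefficients can be taken to
        be 1.\<close>
      proof (cases "\<exists>i<t. a i \<noteq> 0")
        case True
        then show ?thesis
          unfolding mats_lin_dependent_def using relg by (intro exI[of _ a] conjI) (auto intro!: eq_matI)
      next
        case False
        then have at: "a t \<noteq> 0" using a(1) by (auto simp: less_Suc_eq)
        have ft: "nc_eval n r (f t) $$ (i, j) = 0" if "i < n" "j < n" for i j
          using rel[OF that] False at by simp
        then have "L r (f t) = 0" unfolding L_def by (intro sum.neutral) auto
        then have "nc_eval n r (g k) $$ (i, j) = 0" if "i < n" "j < n" for k i j
          using g_eval[OF r that] ft[OF that] by simp
        then show ?thesis
          unfolding mats_lin_dependent_def using t0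
          by (intro exI[of _ "\<lambda>_. 1"] conjI) (auto intro!: eq_matI)
      qed
    qed
    then obtain c i0 where c: "\<And>i. i < t \<Longrightarrow> central_poly n (c i)" and i0: "i0 < t" "\<not> poly_identity n (c i0)"
      and rel: "poly_identity n (\<Sum>i<t. ncmult (c i) (g i))"
      using Suc.IH by blast
    \<comment> \<open>The relation among the \<open>g k\<close>, regrouped by the polynomials
      \<open>f i\<close>: every \<open>g k\<close> contributes \<open>- c k Q (f k)\<close> to the
      coefficient of the pivot \<open>f t\<close>.\<close>
    define d where "d i = (if i = t then - (\<Sum>k<t. ncmult (c k) (Q (f k))) else ncmult (c i) (Q (f t)))" for i
    have d: "central_poly n (d i)" if "i < Suc t" for i
      using that c by (auto simp: d_def less_Suc_eq
          intro!: central_poly_mult central_poly_uminus central_poly_sum n Q_central)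
    \<comment> \<open>Nontriviality survives because a product of two central non-identities is not
      an identity.\<close>
    have "\<not> poly_identity n (d i0)"
      using i0 c central_poly_mult_nonidentity[OF n c[OF i0(1)] i0(2) Q_central Qft] by (simp add: d_def)
    moreover have "poly_identity n (\<Sum>i<Suc t. ncmult (d i) (f i))"
      unfolding poly_identity_def
    proof (intro allI impI eq_matI)
      fix r :: "nat \<Rightarrow> 'a mat" and i j
      assume r: "matrix_assignment n r" and "i < dim_row (0\<^sub>m n n :: 'a mat)" "j < dim_col (0\<^sub>m n n :: 'a mat)"
      then have ij: "i < n" "j < n" by simp_all
      define s where "s k = nc_eval n r (c k) $$ (0, 0)" for k
      have c_eval: "nc_eval n r (c k) = s k \<cdot>\<^sub>m 1\<^sub>m n" if "k < t" for k
        unfolding s_def by (rule central_poly_scalar[OF n c[OF that] r])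
      have d_scalar: "nc_eval n r (d k) = (nc_eval n r (d k) $$ (0, 0)) \<cdot>\<^sub>m 1\<^sub>m n" if "k < Suc t" for k
        by (rule central_poly_scalar[OF n d[OF that] r])
      have d_entry: "nc_eval n r (d k) $$ (0, 0) = s k * L r (f t)" if "k < t" for k
        using that n0 nc_eval_mult_scalar[OF r c_eval[OF that] n0 n0, of "Q (f t)"]
        by (simp add: d_def Q_eval[OF r])
      have "nc_eval n r (ncmult (c k) (Q (f k))) $$ (0, 0) = s k * L r (f k)" if "k < t" for k
        using n0 nc_eval_mult_scalar[OF r c_eval[OF that] n0 n0, of "Q (f k)"]
        by (simp add: Q_eval[OF r])
      then have dt_entry: "nc_eval n r (d t) $$ (0, 0) = - (\<Sum>k<t. s k * L r (f k))"
        by (simp add: d_def nc_eval_uminus nc_eval_sum n0)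
      let ?f = "\<lambda>k. nc_eval n r (f k) $$ (i, j)"
      have "nc_eval n r (\<Sum>k<Suc t. ncmult (d k) (f k)) $$ (i, j) = (\<Sum>k<Suc t. nc_eval n r (d k) $$ (0, 0) * ?f k)"
        unfolding nc_eval_sum[OF ij] by (intro sum.cong refl nc_eval_mult_scalar[OF r d_scalar ij]) simp
      also have "\<dots> = (\<Sum>k<t. s k * L r (f t) * ?f k) - (\<Sum>k<t. s k * L r (f k)) * ?f t"
        by (simp add: d_entry dt_entry)
      also have "\<dots> = (\<Sum>k<t. s k * (L r (f t) * ?f k - L r (f k) * ?f t))"
        by (simp add: sum_distrib_right right_diff_distrib sum_subtractf mult.assoc)
      also have "\<dots> = nc_eval n r (\<Sum>k<t. ncmult (c k) (g k)) $$ (i, j)"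
        unfolding nc_eval_sum[OF ij]
        by (intro sum.cong refl) (simp add: nc_eval_mult_scalar[OF r c_eval ij] g_eval[OF r ij])
      also have "\<dots> = 0" using rel r ij by (simp add: poly_identity_def)
      finally show "nc_eval n r (\<Sum>k<Suc t. ncmult (d k) (f k)) $$ (i, j) = 0\<^sub>m n n $$ (i, j)" using ij by simp
    qed simp_all
    moreover have "i0 < Suc t" using i0(1) by simp
    ultimately show ?thesis using d by (intro exI[of _ d]) blast
  qed
qed

theorem mainTheorem12:
  fixes f :: "nat \<Rightarrow> 'a::field_char_0 ncpoly" and n t :: nat
  assumes "n \<ge> 1"
  shows "locally_lin_dependent n t f \<longleftrightarrow>
    (\<exists>c. (\<forall>i<t. central_poly n (c i)) \<and> (\<exists>i<t. \<not> poly_identity n (c i)) \<and>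
         poly_identity n (\<Sum>i<t. ncmult (c i) (f i)))"
  using locally_lin_dependent_imp_central_relation[OF assms]
    central_relation_imp_locally_lin_dependent[OF assms] by blast

end
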